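(* Every pentagonal graph $G$ is $58000$-colourable, i.e. $\chi(G)\le 58000$.
   Context: All graphs are finite, without loops or parallel edges. An induced cycle is an induced subgraph that is a cycle (of length at least three); its length is its number of edges. A graph is pentagonal if every induced odd cycle in it has length five (in particular, it has no triangles). $\chi(G)$ is the chromatic number of $G$. *)

theory Defs
  imports "Graph_Theory.Graph_Theory"
begin

text \<open>
  A finite simple graph is a \<^locale>\<open>pair_graph\<close>: a finite vertex set with a symmetric,
  irreflexive set of ordered pairs. An undirected edge uv is thus represented by the two
  arcs (u,v) and (v,u).
\<close>

definition edges :: "'a pair_pre_digraph \<Rightarrow> 'a set set" where
  "edges G = (\<lambda>(u, v). {u, v}) ` parcs G"

text \<open>
  A graph that is a cycle: one closed walk without repeated vertices runs through every
  vertex and, up to orientation, every edge. The bound on the length is needed because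
  \<^const>\<open>pre_digraph.cycle\<close> also admits the walk u, v, u along a single edge.
\<close>
definition is_cycle_graph :: "'a pair_pre_digraph \<Rightarrow> bool" where
  "is_cycle_graph C \<longleftrightarrow> pair_graph C \<and>
     (\<exists>p. pre_digraph.cycle (with_proj C) p \<and> 3 \<le> length p \<and>
          pverts C = fst ` set p \<and> parcs C = set p \<union> (set p)\<inverse>)"

definition induced_cycle :: "'a pair_pre_digraph \<Rightarrow> 'a pair_pre_digraph \<Rightarrow> bool" where
  "induced_cycle C G \<longleftrightarrow> induced_subgraph (with_proj C) (with_proj G) \<and> is_cycle_graph C"

definition cycle_length :: "'a pair_pre_digraph \<Rightarrow> nat" where
  "cycle_length C = card (edges C)"

definition pentagonal :: "'a pair_pre_digraph \<Rightarrow> bool" where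
  "pentagonal G \<longleftrightarrow> (\<forall>C. induced_cycle C G \<and> odd (cycle_length C) \<longrightarrow> cycle_length C = 5)"

definition proper_colouring :: "'a pair_pre_digraph \<Rightarrow> nat \<Rightarrow> ('a \<Rightarrow> nat) \<Rightarrow> bool" where
  "proper_colouring G k c \<longleftrightarrow> c ` pverts G \<subseteq> {..<k} \<and> (\<forall>(u, v) \<in> parcs G. c u \<noteq> c v)"

definition colourable :: "'a pair_pre_digraph \<Rightarrow> nat \<Rightarrow> bool" where
  "colourable G k \<longleftrightarrow> (\<exists>c. proper_colouring G k c)"

definition chromatic_number :: "'a pair_pre_digraph \<Rightarrow> nat" where
  "chromatic_number G = (LEAST k. colourable G k)"

lemma colourable_mono: "colourable G k \<Longrightarrow> k \<le> l \<Longrightarrow> colourable G l"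
  unfolding colourable_def proper_colouring_def by (meson lessThan_subset_iff subset_trans)

lemma colourable_card:
  assumes "pair_graph G"
  shows "colourable G (card (pverts G))"
proof -
  interpret pair_graph G by fact
  obtain c where c: "bij_betw c (pverts G) {0..<card (pverts G)}"
    using ex_bij_betw_finite_nat[OF pair_finite_verts] by blast
  have "c u \<noteq> c v" if "(u, v) \<in> parcs G" for u v
    using that c arc_fst_in_verts[OF that] arc_snd_in_verts[OF that] pair_no_loops[OF that]
    by (metis bij_betw_imp_inj_on fst_conv inj_onD snd_conv)
  moreover have "c ` pverts G \<subseteq> {..<card (pverts G)}"
    using bij_betw_imp_surj_on[OF c] by (simp add: lessThan_atLeast0)
  ultimately show ?thesis
    unfolding colourable_def proper_colouring_def by blast
qed

lemma chromatic_number_le_iff: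
  assumes "pair_graph G"
  shows "chromatic_number G \<le> k \<longleftrightarrow> colourable G k"
  unfolding chromatic_number_def
  using colourable_mono[OF LeastI[of "colourable G", OF colourable_card[OF assms]]]
    Least_le[of "colourable G" k] by blast

end

theory Submission
  imports Defs
begin

text \<open>
  If every set of vertices at distance two from a vertex is \<open>k\<close>-colourable, then the whole graph
  is \<open>(18k + 14)\<close>-colourable: in a breadth-first search, after the neighbours of two vertices are
  deleted from a level, the parity of the induced paths leading back through the upper levels splits the
  parents of the remaining vertices into two classes, and a part of large chromatic number would
  see two adjacent vertices of the level from one class, hence close up to odd holes of two
  consecutive lengths greater than five.

  This reduction is applied three times. After passing to vertices at distance two from \<open>v\<close>, then
  from a vertex \<open>a\<close> in that set, the remaining vertices at distance two from \<open>b\<close> are covered by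
  few sets in which no pentagon can exist, because two families of hub sets, compared along
  the induced three-vertex paths of a pentagon, would have to be nested in a contradictory way.
\<close>

text \<open>Length five is the obstacle: two paths that close up to an odd hole contradict the
  hypothesis only if the hole is longer than that. This is why two neighbourhoods are deleted from a
  level: a path from \<open>q0\<close> through the level into the rest must then pass
  \<open>t\<close> and \<open>c\<close>, so that the holes in question have at least six vertices
  and must be even. A vertex to which a parity argument does not apply has a parent adjacent to one
  of a few fixed vertices, hence lies at distance two from that vertex. Each fixed vertex costs
  \<open>k\<close> colours: five occur in the shield argument and four around the root. Together
  with the constants this gives \<open>9 * k + 7\<close> for a level, and twice as much for the even
  and the odd levels. The base value 8 becomes 18 * 8 + 14 = 158, then 161 with three colours for
  exceptional vertices, then 2912 and finally 52430, which is below 58000.\<close>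

locale sgraph =
  fixes adj :: "'a \<Rightarrow> 'a \<Rightarrow> bool"
  assumes adj_sym: "adj x y \<Longrightarrow> adj y x"
    and adj_irrefl: "\<not> adj x x"
begin

lemma adj_commute: "adj x y \<longleftrightarrow> adj y x"
  using adj_sym by blast

section \<open>Induced paths\<close>

fun ipath :: "'a list \<Rightarrow> bool" where
  "ipath [] \<longleftrightarrow> True"
| "ipath [x] \<longleftrightarrow> True"
| "ipath (x # y # zs) \<longleftrightarrow> adj x y \<and> (\<forall>z\<in>set zs. \<not> adj x z \<and> x \<noteq> z) \<and> ipath (y # zs)"

lemma ipath_Cons:
  "ipath (x # ys) \<longleftrightarrow> ys = [] \<or>
    adj x (hd ys) \<and> (\<forall>z\<in>set ys. x \<noteq> z \<and> (adj x z \<longrightarrow> z = hd ys)) \<and> ipath ys"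
proof (cases ys)
  case (Cons y zs)
  have "\<forall>z\<in>set zs. y \<noteq> z" if "ipath (y # zs)"
    using that adj_irrefl by (cases zs) auto
  then show ?thesis
    using Cons adj_irrefl by auto
qed simp

lemma ipath_distinct: "ipath xs \<Longrightarrow> distinct xs"
  by (induction xs) (auto simp: ipath_Cons)

lemma ipath_append:
  assumes "xs \<noteq> []" "ys \<noteq> []"
  shows "ipath (xs @ ys) \<longleftrightarrow> ipath xs \<and> ipath ys \<and> adj (last xs) (hd ys) \<and>
    (\<forall>x\<in>set xs. \<forall>y\<in>set ys. x \<noteq> y \<and> (adj x y \<longrightarrow> x = last xs \<and> y = hd ys))"
  using assms(1)
proof (induction xs rule: list_nonempty_induct)
  case (single x)
  then show ?case using assms(2) by (auto simp: ipath_Cons)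
next
  case (cons x xs)
  have ends: "last xs \<in> set xs" "hd xs \<in> set xs" using cons.hyps by auto
  have 1: "ipath ((x # xs) @ ys) \<longleftrightarrow>
      ipath (x # xs) \<and> (\<forall>z\<in>set ys. x \<noteq> z \<and> (adj x z \<longrightarrow> z = hd xs)) \<and> ipath (xs @ ys)"
    using cons.hyps cons.IH by (auto simp: ipath_Cons[of x])
  have 2: "(\<forall>z\<in>set ys. x \<noteq> z \<and> (adj x z \<longrightarrow> z = hd xs)) \<longleftrightarrow>
      (\<forall>z\<in>set ys. x \<noteq> z \<and> (adj x z \<longrightarrow> x = last xs \<and> z = hd ys))"
    if "ipath (x # xs)" "\<forall>u\<in>set xs. \<forall>z\<in>set ys. u \<noteq> z"
  proof -
    have "x \<noteq> last xs" using ipath_distinct[OF that(1)] ends(1) by auto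
    then show ?thesis using that(2) ends(2) by blast
  qed
  have 3: "ipath (x # xs) \<Longrightarrow> ipath xs" using cons.hyps by (simp add: ipath_Cons[of x])
  have "ipath ((x # xs) @ ys) \<longleftrightarrow> ipath (x # xs) \<and> ipath (xs @ ys) \<and>
      (\<forall>z\<in>set ys. x \<noteq> z \<and> (adj x z \<longrightarrow> x = last xs \<and> z = hd ys))"
    using 1 2 cons.IH by blast
  then show ?case using 3 cons.IH cons.hyps by (simp, blast)
qed

lemma ipath_appendI:
  assumes "ipath xs" "ipath ys" "xs \<noteq> []" "ys \<noteq> []" "last xs = a" "hd ys = b" "adj a b"
    and "\<And>x y. x \<in> set xs \<Longrightarrow> y \<in> set ys \<Longrightarrow> x \<noteq> y \<and> (adj x y \<longrightarrow> x = a \<and> y = b)"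
  shows "ipath (xs @ ys)"
  unfolding ipath_append[OF assms(3,4)] using assms by blast

lemma ipath_appendD:
  assumes "ipath (xs @ ys)"
  shows "ipath xs" "ipath ys"
  using assms ipath_append[of xs ys] by (cases "xs = []"; cases "ys = []"; simp)+

lemma ipath_rev: "ipath (rev xs) \<longleftrightarrow> ipath xs"
proof (induction xs)
  case (Cons x xs)
  show ?case
  proof (cases "xs = []")
    case False
    then show ?thesis
      using Cons ipath_append[of "rev xs" "[x]"]
      by (auto simp: ipath_Cons last_rev adj_commute)
  qed simp
qed simp

lemma ipath_snoc:
  "ipath (xs @ [y]) \<longleftrightarrow> xs = [] \<or>
    adj (last xs) y \<and> (\<forall>z\<in>set xs. y \<noteq> z \<and> (adj y z \<longrightarrow> z = last xs)) \<and> ipath xs"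
  using ipath_append[of xs "[y]"] by (cases "xs = []") (auto simp: adj_commute)

lemma ipath_adj_iff:
  "ipath xs \<Longrightarrow> u \<in> set xs \<Longrightarrow> v \<in> set xs \<Longrightarrow>
    adj u v \<longleftrightarrow> (u, v) \<in> set (zip xs (tl xs)) \<or> (v, u) \<in> set (zip xs (tl xs))"
proof (induction xs)
  case (Cons x xs)
  show ?case
  proof (cases xs)
    case Nil
    then show ?thesis using Cons.prems adj_irrefl by auto
  next
    case (Cons y ys)
    note xs = Cons
    have x: "x \<notin> set xs" using ipath_distinct[OF Cons.prems(1)] by simp
    have adj_x: "adj x w \<longleftrightarrow> w = y" if "w \<in> set xs" for w
      using Cons.prems(1) that by (auto simp: ipath_Cons[of x] xs)
    have fresh: "(x, w) \<notin> set (zip xs (tl xs))" "(w, x) \<notin> set (zip xs (tl xs))" for w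
      using x set_zip_leftD[of x w xs "tl xs"] set_zip_rightD[of w x xs "tl xs"] list.set_sel(2)[of xs x]
      by (auto simp: xs)
    have z: "set (zip (x # xs) (tl (x # xs))) = insert (x, y) (set (zip xs (tl xs)))" by (simp add: xs)
    have "ipath xs" using Cons.prems(1) by (simp add: ipath_Cons[of x] xs)
    then have IH: "u \<in> set xs \<Longrightarrow> v \<in> set xs \<Longrightarrow>
        adj u v \<longleftrightarrow> (u, v) \<in> set (zip xs (tl xs)) \<or> (v, u) \<in> set (zip xs (tl xs))"
      using Cons.IH by blast
    have "x \<noteq> y" using x xs by auto
    consider "u = x" "v = x" | "u = x" "v \<in> set xs" | "u \<in> set xs" "v = x" | "u \<in> set xs" "v \<in> set xs"
      using Cons.prems(2,3) by auto
    then show ?thesis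
    proof cases
      case 1
      then show ?thesis using fresh adj_irrefl[of x] \<open>x \<noteq> y\<close> unfolding z by simp
    next
      case 2
      then show ?thesis using fresh adj_x[of v] \<open>x \<noteq> y\<close> unfolding z by auto
    next
      case 3
      then show ?thesis using fresh adj_x[of u] \<open>x \<noteq> y\<close> adj_commute[of u x] unfolding z by auto
    next
      case 4
      then show ?thesis using IH x unfolding z by auto
    qed
  qed
qed simp

section \<open>Connectivity and induced paths inside a set\<close>

definition reach :: "'a set \<Rightarrow> 'a \<Rightarrow> 'a \<Rightarrow> bool" where
  "reach S = (\<lambda>u v. u \<in> S \<and> v \<in> S \<and> adj u v)\<^sup>*\<^sup>*"

definition conn :: "'a set \<Rightarrow> bool" where
  "conn S \<longleftrightarrow> (\<forall>x\<in>S. \<forall>y\<in>S. reach S x y)"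

definition comp :: "'a set \<Rightarrow> 'a \<Rightarrow> 'a set" where
  "comp S x = {y. reach S x y}"

lemma reach_refl [simp]: "reach S x x"
  by (simp add: reach_def)

lemma reach_trans: "reach S x y \<Longrightarrow> reach S y z \<Longrightarrow> reach S x z"
  by (simp add: reach_def)

lemma reach_step: "x \<in> S \<Longrightarrow> y \<in> S \<Longrightarrow> adj x y \<Longrightarrow> reach S x y"
  by (simp add: reach_def r_into_rtranclp)

lemma reach_sym: "reach S x y \<Longrightarrow> reach S y x"
  unfolding reach_def
  by (rule sympD[OF symp_rtranclp]) (auto simp: symp_def adj_commute)

lemma reach_mono: "reach S x y \<Longrightarrow> S \<subseteq> T \<Longrightarrow> reach T x y"
  unfolding reach_def by (erule rtranclp_mono[THEN predicate2D, rotated]) auto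

lemma reach_in: "reach S x y \<Longrightarrow> x \<in> S \<Longrightarrow> y \<in> S"
  unfolding reach_def by (induction rule: rtranclp_induct) auto

lemma comp_subset: "x \<in> S \<Longrightarrow> comp S x \<subseteq> S"
  using reach_in by (auto simp: comp_def)

lemma self_in_comp [simp]: "x \<in> comp S x"
  by (simp add: comp_def)

lemma reach_comp: "reach S x y \<Longrightarrow> reach (comp S x) x y"
  unfolding reach_def
proof (induction rule: rtranclp_induct)
  case (step y z)
  then have "y \<in> comp S x" "z \<in> comp S x"
    by (auto simp: comp_def reach_def intro: rtranclp.rtrancl_into_rtrancl)
  then show ?case using step by (auto intro: rtranclp.rtrancl_into_rtrancl)
qed simp

lemma conn_comp: "conn (comp S x)"
  unfolding conn_def
proof (intro ballI)
  fix y z assume "y \<in> comp S x" "z \<in> comp S x"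
  then show "reach (comp S x) y z"
    by (metis comp_def mem_Collect_eq reach_comp reach_sym reach_trans)
qed

lemma comp_closed: "y \<in> comp S x \<Longrightarrow> x \<in> S \<Longrightarrow> z \<in> S \<Longrightarrow> adj y z \<Longrightarrow> z \<in> comp S x"
  using reach_trans[of S x y z] reach_step[of y S z] reach_in[of S x y] by (simp add: comp_def)

lemma comp_eq:
  assumes "y \<in> comp S x"
  shows "comp S y = comp S x"
proof -
  have "reach S x y" using assms by (simp add: comp_def)
  then show ?thesis
    unfolding comp_def using reach_trans[of S x y] reach_trans[of S y x] reach_sym[of S x y] by blast
qed

lemma conn_insert:
  assumes "conn S" "y \<in> S" "adj x y"
  shows "conn (insert x S)"
proof -
  have a: "reach (insert x S) u y" if "u \<in> insert x S" for u
  proof (cases "u = x")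
    case True
    then show ?thesis using assms by (auto intro: reach_step)
  next
    case False
    then show ?thesis using assms that reach_mono[of S u y "insert x S"] by (auto simp: conn_def)
  qed
  then show ?thesis unfolding conn_def by (meson reach_sym reach_trans)
qed

lemma conn_crossing:
  assumes "conn S" "x \<in> S" "x \<in> A" "y \<in> S" "y \<notin> A"
  obtains u w where "u \<in> S" "u \<in> A" "w \<in> S" "w \<notin> A" "adj u w"
proof -
  have "reach S x y" using assms by (auto simp: conn_def)
  then have "y \<in> A \<or> (\<exists>u w. u \<in> S \<and> u \<in> A \<and> w \<in> S \<and> w \<notin> A \<and> adj u w)"
    unfolding reach_def
    by (induction rule: rtranclp_induct) (use assms(3) in auto)
  then show ?thesis using that assms by blast
qed

text \<open>Follow the walk and keep an induced path to its current end. A new vertex that is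
  already on the path truncates it; any other is joined to its first neighbour on the path, and
  whatever comes after that neighbour is dropped.\<close>

lemma ipath_exists:
  assumes "reach S x y" "x \<in> S"
  shows "\<exists>xs. xs \<noteq> [] \<and> ipath xs \<and> hd xs = x \<and> last xs = y \<and> set xs \<subseteq> S"
  using assms(1) unfolding reach_def
proof (induction rule: rtranclp_induct)
  case base
  then show ?case using assms(2) by (intro exI[of _ "[x]"]) auto
next
  case (step y z)
  then obtain xs where xs: "xs \<noteq> []" "ipath xs" "hd xs = x" "last xs = y" "set xs \<subseteq> S"
    by blast
  show ?case
  proof (cases "z \<in> set xs")
    case True
    then obtain as bs where "xs = as @ z # bs" by (meson split_list)
    then have "ipath (as @ [z])" "hd (as @ [z]) = x" "set (as @ [z]) \<subseteq> S"
      using xs ipath_appendD(1)[of "as @ [z]" bs] by (auto simp: hd_append)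
    then show ?thesis by (intro exI[of _ "as @ [z]"]) auto
  next
    case False
    have "\<exists>w\<in>set xs. adj z w" using xs(1,4) step(2) adj_sym last_in_set by metis
    then obtain as w bs where w: "xs = as @ w # bs" "adj z w" "\<forall>u\<in>set as. \<not> adj z u"
      using split_list_first_prop[of xs "adj z"] by blast
    have "ipath ((as @ [w]) @ [z])"
      unfolding ipath_snoc[of "as @ [w]" z]
      using w xs False ipath_appendD(1)[of "as @ [w]" bs] by (auto simp: adj_commute)
    moreover have "hd ((as @ [w]) @ [z]) = x" using w xs by (auto simp: hd_append)
    moreover have "set ((as @ [w]) @ [z]) \<subseteq> S" using w(1) xs(5) step(2) by auto
    ultimately show ?thesis
      by (intro exI[of _ "(as @ [w]) @ [z]"]) simp
  qed
qed

text \<open>Typically \<open>A\<close> consists of the neighbours of a vertex off the path: stopping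
  at the first of them allows that vertex to be appended without a chord.\<close>

lemma first_hit:
  assumes "reach S x y" "x \<in> S" "y \<in> A"
  obtains xs z where "ipath (xs @ [z])" "hd (xs @ [z]) = x" "z \<in> A" "set (xs @ [z]) \<subseteq> S"
    "\<forall>u\<in>set xs. u \<notin> A"
proof -
  obtain ps where ps: "ps \<noteq> []" "ipath ps" "hd ps = x" "last ps = y" "set ps \<subseteq> S"
    using ipath_exists[OF assms(1,2)] by blast
  then have "\<exists>z\<in>set ps. z \<in> A" using assms(3) last_in_set by metis
  then obtain xs z zs where z: "ps = xs @ z # zs" "z \<in> A" "\<forall>u\<in>set xs. u \<notin> A"
    using split_list_first_prop[of ps "\<lambda>z. z \<in> A"] by blast
  then show ?thesis
    using that[of xs z] ps ipath_appendD(1)[of "xs @ [z]" zs] by (auto simp: hd_append)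
qed

section \<open>Colourings\<close>

definition col :: "'a set \<Rightarrow> nat \<Rightarrow> bool" where
  "col S k \<longleftrightarrow> (\<exists>f. (\<forall>x\<in>S. f x < k) \<and> (\<forall>x\<in>S. \<forall>y\<in>S. adj x y \<longrightarrow> f x \<noteq> f y))"

lemma col_mono: "col S k \<Longrightarrow> T \<subseteq> S \<Longrightarrow> k \<le> l \<Longrightarrow> col T l"
  unfolding col_def by (meson order_less_le_trans subsetD)

lemma col_empty [simp]: "col {} k"
  by (simp add: col_def)

lemma col_stable: "(\<And>x y. x \<in> S \<Longrightarrow> y \<in> S \<Longrightarrow> \<not> adj x y) \<Longrightarrow> col S 1"
  unfolding col_def by (intro exI[of _ "\<lambda>_. 0"]) auto

lemma col_Un:
  assumes "col S k" "col T l"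
  shows "col (S \<union> T) (k + l)"
proof -
  obtain f where f: "\<forall>x\<in>S. f x < k" "\<forall>x\<in>S. \<forall>y\<in>S. adj x y \<longrightarrow> f x \<noteq> f y"
    using assms(1) by (auto simp: col_def)
  obtain g where g: "\<forall>x\<in>T. g x < l" "\<forall>x\<in>T. \<forall>y\<in>T. adj x y \<longrightarrow> g x \<noteq> g y"
    using assms(2) by (auto simp: col_def)
  show ?thesis
    unfolding col_def
  proof (intro exI[of _ "\<lambda>x. if x \<in> S then f x else k + g x"] conjI ballI impI)
    fix x assume "x \<in> S \<union> T"
    then show "(if x \<in> S then f x else k + g x) < k + l" using f(1) g(1) by (auto simp: trans_less_add1)
  next
    fix x y assume "x \<in> S \<union> T" "y \<in> S \<union> T" "adj x y"
    then show "(if x \<in> S then f x else k + g x) \<noteq> (if y \<in> S then f y else k + g y)"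
      using f(1)[rule_format, of x] f(1)[rule_format, of y] f(2)[rule_format, of x y]
        g(2)[rule_format, of x y] by auto
  qed
qed

lemma col_Un_le: "col S k \<Longrightarrow> col T l \<Longrightarrow> X \<subseteq> S \<union> T \<Longrightarrow> k + l \<le> m \<Longrightarrow> col X m"
  using col_Un col_mono by blast

lemma col_comps:
  assumes "\<And>x. x \<in> S \<Longrightarrow> col (comp S x) k"
  shows "col S k"
proof -
  define good where "good T f \<longleftrightarrow> (\<forall>x\<in>T. f x < k) \<and> (\<forall>x\<in>T. \<forall>y\<in>T. adj x y \<longrightarrow> f x \<noteq> f y)"
    for T :: "'a set" and f :: "'a \<Rightarrow> nat"
  \<comment> \<open>The choice depends only on the component as a set, so adjacent vertices are
    coloured by the same function.\<close>
  define F where "F T = (SOME f. good T f)" for T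
  have F: "good (comp S x) (F (comp S x))" if "x \<in> S" for x
  proof -
    have "\<exists>f. good (comp S x) f" using assms[OF that] by (simp add: col_def good_def)
    then show ?thesis unfolding F_def by (rule someI_ex)
  qed
  show ?thesis
    unfolding col_def
  proof (intro exI[of _ "\<lambda>x. F (comp S x) x"] conjI ballI impI)
    fix x assume "x \<in> S"
    then show "F (comp S x) x < k" using F by (auto simp: good_def)
  next
    fix x y assume *: "x \<in> S" "y \<in> S" "adj x y"
    then have "y \<in> comp S x" using comp_closed[of x S x y] by simp
    then show "F (comp S x) x \<noteq> F (comp S y) y"
      using F[of x] * comp_eq[of y S x] by (auto simp: good_def)
  qed
qed

lemma col_Un_anticomplete:
  assumes "col S k" "col T k" "\<And>x y. x \<in> S \<Longrightarrow> y \<in> T \<Longrightarrow> \<not> adj x y"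
  shows "col (S \<union> T) k"
proof -
  obtain f where f: "\<forall>x\<in>S. f x < k" "\<forall>x\<in>S. \<forall>y\<in>S. adj x y \<longrightarrow> f x \<noteq> f y"
    using assms(1) by (auto simp: col_def)
  obtain g where g: "\<forall>x\<in>T. g x < k" "\<forall>x\<in>T. \<forall>y\<in>T. adj x y \<longrightarrow> g x \<noteq> g y"
    using assms(2) by (auto simp: col_def)
  show ?thesis
    unfolding col_def
  proof (intro exI[of _ "\<lambda>x. if x \<in> S then f x else g x"] conjI ballI impI)
    fix x y assume "x \<in> S \<union> T" "y \<in> S \<union> T" "adj x y"
    then show "(if x \<in> S then f x else g x) \<noteq> (if y \<in> S then f y else g y)"
      using f(2)[rule_format, of x y] g(2)[rule_format, of x y]
        assms(3)[of x y] assms(3)[of y x] adj_sym[of x y] by auto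
  qed (use f g in auto)
qed

lemma ipath_alternating:
  assumes "ipath ys" "\<And>x y. x \<in> set ys \<Longrightarrow> y \<in> set ys \<Longrightarrow> adj x y \<Longrightarrow> f x \<noteq> f y"
    and "\<And>x. x \<in> set ys \<Longrightarrow> f x < (2::nat)" "ys \<noteq> []"
  shows "even (length ys) \<longleftrightarrow> f (hd ys) \<noteq> f (last ys)"
  using assms(4,1,2,3)
proof (induction ys rule: list_nonempty_induct)
  case (cons x xs)
  have i: "ipath xs" "adj x (hd xs)"
    using cons.prems(1) cons.hyps(1) by (auto simp: ipath_Cons[of x])
  have h: "hd xs \<in> set xs" "last xs \<in> set xs" using cons.hyps(1) by auto
  have "even (length xs) \<longleftrightarrow> f (hd xs) \<noteq> f (last xs)"
    using cons.IH[OF i(1)] cons.prems(2,3) by simp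
  moreover have "f x \<noteq> f (hd xs)" "f x < 2" "f (hd xs) < 2" "f (last xs) < 2"
    using i(2) h cons.prems(2,3) by simp_all
  ultimately show ?case using cons.hyps(1) by auto
qed simp

text \<open>A two-colouring of \<open>S\<close> extends to one more vertex \<open>v\<close> after swapping colours in components,
  unless two neighbours of \<open>v\<close> in one component get different colours; a shortest path between
  two such neighbours then closes up to an odd hole through \<open>v\<close>.\<close>

lemma bipartite_if_no_odd_hole:
  assumes "finite S"
    and "\<And>x ys. \<lbrakk>x \<in> S; set ys \<subseteq> S; ipath ys; length ys \<ge> 2; even (length ys); x \<notin> set ys;
        adj x (hd ys); adj x (last ys); \<forall>z\<in>set ys. adj x z \<longrightarrow> z = hd ys \<or> z = last ys\<rbrakk> \<Longrightarrow> False"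
  shows "col S 2"
  using assms
proof (induction S rule: finite_induct)
  case (insert v S)
  have "col S 2"
    by (rule insert.IH) (use insert.prems in blast)
  then obtain f where f: "\<forall>x\<in>S. f x < (2::nat)" "\<forall>x\<in>S. \<forall>y\<in>S. adj x y \<longrightarrow> f x \<noteq> f y"
    unfolding col_def by blast
  have same: "f a = f b" if ab: "a \<in> S" "adj v a" "b \<in> S" "adj v b" "reach S a b" for a b
  proof (rule ccontr)
    assume "f a \<noteq> f b"
    then have "b \<in> {b. adj v b \<and> f b \<noteq> f a}" using ab by auto
    then obtain xs z where z0: "ipath (xs @ [z])" "hd (xs @ [z]) = a"
      "z \<in> {b. adj v b \<and> f b \<noteq> f a}" "set (xs @ [z]) \<subseteq> S" "\<forall>u\<in>set xs. u \<notin> {b. adj v b \<and> f b \<noteq> f a}"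
      using first_hit[OF ab(5,1), of "{b. adj v b \<and> f b \<noteq> f a}" thesis] by blast
    then have z: "ipath (xs @ [z])" "hd (xs @ [z]) = a" "adj v z" "f z \<noteq> f a"
      "set (xs @ [z]) \<subseteq> S" "\<forall>u\<in>set xs. adj v u \<longrightarrow> f u = f a" by auto
    have ne: "xs \<noteq> []" using z(2,4) by auto
    then have "hd xs = a" using z(2) by simp
    then have "\<exists>u\<in>set xs. adj v u" using ab(2) hd_in_set[OF ne] by blast
    then obtain as w bs where w: "xs = as @ w # bs" "adj v w" "\<forall>u\<in>set bs. \<not> adj v u"
      using split_list_last_prop[of xs "adj v"] by blast
    \<comment> \<open>\<open>z\<close> is the first neighbour of \<open>v\<close> whose colour
      differs from that of \<open>a\<close>, so the last neighbour \<open>w\<close> before it has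
      the colour of \<open>a\<close>. No vertex strictly between them sees \<open>v\<close>, and the
      different colours at the ends make the number of vertices even.\<close>
    define ys where "ys = w # bs @ [z]"
    have i: "ipath ys" using z w ipath_appendD(2)[of as ys] by (simp add: ys_def)
    have sub: "set ys \<subseteq> S" using z(5) w(1) by (auto simp: ys_def)
    have "f w \<noteq> f z" using z(4,6) w(1,2) by auto
    then have ev: "even (length ys)"
      using ipath_alternating[OF i, of f] f sub by (auto simp: ys_def)
    have "v \<notin> set ys" using sub insert.hyps(2) by blast
    moreover have "\<forall>u\<in>set ys. adj v u \<longrightarrow> u = hd ys \<or> u = last ys" using w(3) by (auto simp: ys_def)
    ultimately show False
      using insert.prems[of v ys] i ev sub z(3) w(2) by (auto simp: ys_def)
  qed
  \<comment> \<open>Colours are swapped in each component that has a neighbour of \<open>v\<close>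
    coloured 1. Then all neighbours of \<open>v\<close> have colour 0 and \<open>v\<close> can take
    1.\<close>
  define c where "c y = (if \<exists>a\<in>S. adj v a \<and> reach S a y \<and> f a = 1 then 1 - f y else f y)" for y
  have c0: "c a = 0" if "a \<in> S" "adj v a" for a
  proof -
    have "f a < 2" using f that by auto
    moreover have "(\<exists>b\<in>S. adj v b \<and> reach S b a \<and> f b = 1) \<longleftrightarrow> f a = 1"
      using same that reach_refl by metis
    ultimately show ?thesis by (auto simp: c_def)
  qed
  have cne: "c x \<noteq> c y" if "x \<in> S" "y \<in> S" "adj x y" for x y
  proof -
    have r: "reach S b x \<longleftrightarrow> reach S b y" for b
      using reach_step[of x S y] reach_step[of y S x] reach_trans that adj_sym by blast
    have "f x < 2" "f y < 2" "f x \<noteq> f y" using f that by auto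
    then show ?thesis by (auto simp: c_def r)
  qed
  have c2: "c x < 2" if "x \<in> S" for x
  proof -
    have "f x < 2" using f that by auto
    then show ?thesis by (auto simp: c_def)
  qed
  show ?case
    unfolding col_def
  proof (intro exI[of _ "\<lambda>x. if x = v then 1 else c x"] conjI ballI impI)
    fix x y assume "x \<in> insert v S" "y \<in> insert v S" "adj x y"
    then show "(if x = v then 1 else c x) \<noteq> (if y = v then 1 else c y)"
      using c0[of x] c0[of y] cne[of x y] adj_irrefl[of v] adj_sym[of x v] by (cases "x = v"; cases "y = v") auto
  qed (use c2 in auto)
qed simp

end

section \<open>Pentagonal graphs\<close>

text \<open>A hole is given by one vertex \<open>x\<close> and the induced path \<open>ys\<close> formed by its other vertices,
  so that length \<open>4\<close> of \<open>ys\<close> means a pentagon.\<close>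

locale pentagonal_graph = sgraph +
  assumes pent: "\<lbrakk>length ys \<ge> 2; ipath ys; x \<notin> set ys; adj x (hd ys); adj x (last ys);
      \<forall>z\<in>set ys. adj x z \<longrightarrow> z = hd ys \<or> z = last ys; even (length ys)\<rbrakk> \<Longrightarrow> length ys = 4"
begin

lemma no_triangle: "adj x y \<Longrightarrow> adj y z \<Longrightarrow> \<not> adj x z"
  using pent[of "[y, z]" x] adj_irrefl by auto

lemma adjacent_ne: "adj x y \<Longrightarrow> x \<noteq> y"
  using adj_irrefl by blast

text \<open>A symmetric form of \<open>pent\<close> for a hole cut into two paths; the first vertex
  of \<open>ps\<close> plays the part of \<open>x\<close>. If a path is a single vertex, its two
  ends coincide and \<open>cross\<close> permits both edges at it.\<close>

lemma hole_parity:
  assumes "ipath ps" "ipath rs" "ps \<noteq> []" "rs \<noteq> []" "length ps + length rs \<ge> 3"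
    and ends: "adj (last ps) (hd rs)" "adj (last rs) (hd ps)"
    and cross: "\<And>x y. x \<in> set ps \<Longrightarrow> y \<in> set rs \<Longrightarrow>
      x \<noteq> y \<and> (adj x y \<longrightarrow> (x = last ps \<and> y = hd rs) \<or> (x = hd ps \<and> y = last rs))"
  shows "even (length ps + length rs) \<or> length ps + length rs = 5"
proof -
  obtain x ps' where ps: "ps = x # ps'" using assms(3) by (cases ps) auto
  define ys where "ys = ps' @ rs"
  have d: "x \<notin> set ps'" using ipath_distinct[OF assms(1)] ps by simp
  have "ipath ys"
  proof (cases "ps' = []")
    case False
    then have "last ps' = last ps" "ipath ps'" using ps assms(1) by (auto simp: ipath_Cons)
    moreover have "u \<noteq> w \<and> (adj u w \<longrightarrow> u = last ps' \<and> w = hd rs)"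
      if "u \<in> set ps'" "w \<in> set rs" for u w
    proof -
      have "u \<noteq> hd ps" using d that(1) ps by auto
      then show ?thesis using cross[of u w] that ps \<open>last ps' = last ps\<close> by auto
    qed
    ultimately show ?thesis
      using assms ends(1) False ipath_append[of ps' rs] by (simp add: ys_def)
  qed (use assms ys_def in simp)
  moreover have "x \<notin> set ys" using d cross[of x] ps by (auto simp: ys_def)
  moreover have "length ys \<ge> 2" using assms(5) ps by (simp add: ys_def)
  moreover have "last ys = last rs" using assms(4) by (simp add: ys_def)
  then have "adj x (last ys)" using ends(2) ps by (simp add: adj_commute)
  moreover have "adj x (hd ys)"
    using ends(1) ps assms(1) by (cases "ps' = []") (auto simp: ys_def ipath_Cons)
  moreover have "\<forall>z\<in>set ys. adj x z \<longrightarrow> z = hd ys \<or> z = last ys"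
  proof (intro ballI impI)
    fix z assume z: "z \<in> set ys" "adj x z"
    show "z = hd ys \<or> z = last ys"
    proof (cases "z \<in> set ps'")
      case True
      then have "z = hd ps'" using assms(1) z ps by (auto simp: ipath_Cons)
      then show ?thesis using True by (cases ps') (auto simp: ys_def)
    next
      case False
      then have zr: "z \<in> set rs" using z by (simp add: ys_def)
      then consider "x = last ps" "z = hd rs" | "z = last rs"
        using cross[of x z] z ps by auto
      then show ?thesis
      proof cases
        case 1
        then have "ps' = []" using d ps last_in_set[of ps'] by (cases "ps' = []") auto
        then show ?thesis using 1 by (simp add: ys_def)
      qed (use \<open>last ys = last rs\<close> in simp)
    qed
  qed
  ultimately have "even (length ys) \<longrightarrow> length ys = 4" using pent[of ys x] by blast
  then show ?thesis using ps by (auto simp: ys_def)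
qed

text \<open>Distinctness follows from the adjacency pattern, because any two positions on the cycle
  have different neighbours. A local argument thus only has to supply seven edges and fourteen
  non-edges.\<close>

lemma no_7_hole:
  assumes "adj a b" "adj b c" "adj c d" "adj d e" "adj e f" "adj f g" "adj g a"
    and "\<not> adj a c" "\<not> adj a d" "\<not> adj a e" "\<not> adj a f"
    and "\<not> adj b d" "\<not> adj b e" "\<not> adj b f" "\<not> adj b g"
    and "\<not> adj c e" "\<not> adj c f" "\<not> adj c g"
    and "\<not> adj d f" "\<not> adj d g" "\<not> adj e g"
  shows False
proof -
  have "distinct [a, b, c, d, e, f, g]"
    using assms adj_irrefl adj_sym by (simp, intro conjI; metis)
  then show False
    using pent[of "[b, c, d, e, f, g]" a] assms adj_sym[of g a] by simp
qed

lemma no_9_hole: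
  assumes "adj a b" "adj b c" "adj c d" "adj d e" "adj e f" "adj f g" "adj g h" "adj h i" "adj i a"
    and "\<not> adj a c" "\<not> adj a d" "\<not> adj a e" "\<not> adj a f" "\<not> adj a g" "\<not> adj a h"
    and "\<not> adj b d" "\<not> adj b e" "\<not> adj b f" "\<not> adj b g" "\<not> adj b h" "\<not> adj b i"
    and "\<not> adj c e" "\<not> adj c f" "\<not> adj c g" "\<not> adj c h" "\<not> adj c i"
    and "\<not> adj d f" "\<not> adj d g" "\<not> adj d h" "\<not> adj d i"
    and "\<not> adj e g" "\<not> adj e h" "\<not> adj e i"
    and "\<not> adj f h" "\<not> adj f i" "\<not> adj g i"
  shows False
proof -
  have "distinct [a, b, c, d, e, f, g, h, i]"
    using assms adj_irrefl adj_sym by (simp, intro conjI; metis)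
  then show False
    using pent[of "[b, c, d, e, f, g, h, i]" a] assms adj_sym[of i a] by simp
qed

lemma bipartite_if_no_pentagon:
  assumes "finite S"
    and "\<And>a b c d e. \<lbrakk>a \<in> S; b \<in> S; c \<in> S; d \<in> S; e \<in> S; adj a b; adj b c; adj c d; adj d e; adj e a;
      \<not> adj a c; \<not> adj b d; \<not> adj c e; \<not> adj d a; \<not> adj e b\<rbrakk> \<Longrightarrow> False"
  shows "col S 2"
  using assms(1)
proof (rule bipartite_if_no_odd_hole)
  fix x ys
  assume *: "x \<in> S" "set ys \<subseteq> S" "ipath ys" "length ys \<ge> 2" "even (length ys)" "x \<notin> set ys"
    "adj x (hd ys)" "adj x (last ys)" "\<forall>z\<in>set ys. adj x z \<longrightarrow> z = hd ys \<or> z = last ys"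
  then have "length ys = 4" using pent by blast
  then obtain b c d e where ys: "ys = [b, c, d, e]"
    by (auto simp: numeral_eq_Suc length_Suc_conv)
  show False
    using assms(2)[of x b c d e] * ys by (auto simp: adj_commute)
qed

text \<open>Each of the five induced three-vertex paths of a pentagon, read in both directions, nests one of
  the two families. Adjacent vertices share no hub, so two nestings of the same family cannot be
  chained, and going round the pentagon gives a contradiction.\<close>

lemma bipartite_if_P3_rule:
  assumes "finite D"
    and S: "\<And>y. y \<in> D \<Longrightarrow> S y \<noteq> {}" "\<And>y s. y \<in> D \<Longrightarrow> s \<in> S y \<Longrightarrow> adj s y"
    and B: "\<And>y. y \<in> D \<Longrightarrow> B y \<noteq> {}" "\<And>y s. y \<in> D \<Longrightarrow> s \<in> B y \<Longrightarrow> adj s y"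
    and P3: "\<And>x y z. \<lbrakk>x \<in> D; y \<in> D; z \<in> D; adj x y; adj y z; \<not> adj x z\<rbrakk> \<Longrightarrow> S x \<subseteq> S z \<or> B z \<subseteq> B x"
  shows "col D 2"
  using assms(1)
proof (rule bipartite_if_no_pentagon)
  fix a b c d e
  assume D: "a \<in> D" "b \<in> D" "c \<in> D" "d \<in> D" "e \<in> D"
    and adj: "adj a b" "adj b c" "adj c d" "adj d e" "adj e a"
    and nadj: "\<not> adj a c" "\<not> adj b d" "\<not> adj c e" "\<not> adj d a" "\<not> adj e b"
  have S_disj: "S x \<inter> S y = {}" if "x \<in> D" "y \<in> D" "adj x y" for x y
    using S(2)[OF that(1)] S(2)[OF that(2)] that(3) no_triangle by (meson disjoint_iff)
  have B_disj: "B x \<inter> B y = {}" if "x \<in> D" "y \<in> D" "adj x y" for x y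
    using B(2)[OF that(1)] B(2)[OF that(2)] that(3) no_triangle by (meson disjoint_iff)
  have no_SS: "\<not> (S x \<subseteq> S y \<and> S y \<subseteq> S z)" "\<not> (S y \<subseteq> S x \<and> S y \<subseteq> S z)" "\<not> (S z \<subseteq> S y \<and> S y \<subseteq> S x)"
    and no_BB: "\<not> (B x \<subseteq> B y \<and> B y \<subseteq> B z)" "\<not> (B y \<subseteq> B x \<and> B y \<subseteq> B z)" "\<not> (B z \<subseteq> B y \<and> B y \<subseteq> B x)"
    if "x \<in> D" "y \<in> D" "z \<in> D" "adj x z" for x y z
    using S_disj[OF that(1,3,4)] B_disj[OF that(1,3,4)] S(1)[of x] S(1)[of y] S(1)[of z]
      B(1)[of x] B(1)[of y] B(1)[of z] that by blast+
  note adj' = adj[THEN adj_sym]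
  have nadj': "\<not> adj c a" "\<not> adj d b" "\<not> adj e c" "\<not> adj a d" "\<not> adj b e"
    using nadj by (simp_all add: adj_commute)
  note rules = P3[OF D(1,2,3) adj(1,2) nadj(1)] P3[OF D(3,2,1) adj'(2,1) nadj'(1)]
    P3[OF D(2,3,4) adj(2,3) nadj(2)] P3[OF D(4,3,2) adj'(3,2) nadj'(2)]
    P3[OF D(3,4,5) adj(3,4) nadj(3)] P3[OF D(5,4,3) adj'(4,3) nadj'(3)]
    P3[OF D(4,5,1) adj(4,5) nadj(4)] P3[OF D(1,5,4) adj'(5,4) nadj'(4)]
    P3[OF D(5,1,2) adj(5,1) nadj(5)] P3[OF D(2,1,5) adj'(1,5) nadj'(5)]
  \<comment> \<open>The diagonals form a second pentagon \<open>a\<close>, \<open>c\<close>,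
    \<open>e\<close>, \<open>b\<close>, \<open>d\<close>, in which the two neighbours of each vertex
    are adjacent in the first one. Reading a diagonal both ways yields equal \<open>S\<close>, equal
    \<open>B\<close>, or inclusions of both families in the same direction. The last case leaves no
    option for the other diagonal at the smaller end, so equal \<open>S\<close> and equal
    \<open>B\<close> would have to alternate around a cycle of length five.\<close>
  note n = no_SS[OF D(1) D(3) D(5) adj'(5)] no_SS[OF D(3) D(5) D(2) adj'(2)]
    no_SS[OF D(5) D(2) D(4) adj'(4)] no_SS[OF D(2) D(4) D(1) adj'(1)]
    no_SS[OF D(4) D(1) D(3) adj'(3)]
    no_BB[OF D(1) D(3) D(5) adj'(5)] no_BB[OF D(3) D(5) D(2) adj'(2)]
    no_BB[OF D(5) D(2) D(4) adj'(4)] no_BB[OF D(2) D(4) D(1) adj'(1)]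
    no_BB[OF D(4) D(1) D(3) adj'(3)]
  show False
    using rules n by argo
qed

section \<open>Vertices at distance two and local bipartiteness\<close>

definition N2 :: "'a set \<Rightarrow> 'a \<Rightarrow> 'a set" where
  "N2 X b = {y \<in> X. y \<noteq> b \<and> \<not> adj b y \<and> (\<exists>w\<in>X. adj b w \<and> adj w y)}"

lemma N2_subset: "N2 X b \<subseteq> X"
  by (auto simp: N2_def)

lemma in_N2: "y \<in> X \<Longrightarrow> y \<noteq> b \<Longrightarrow> w \<in> X \<Longrightarrow> adj b w \<Longrightarrow> adj w y \<Longrightarrow> y \<in> N2 X b"
  using no_triangle[of b w y] by (auto simp: N2_def)

lemma neighbours_stable: "col {y \<in> X. adj x y} 1"
  by (rule col_stable) (use no_triangle adj_sym in blast)

text \<open>If the nesting rule fails at \<open>x\<close>, \<open>y\<close>, \<open>w\<close>,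
  witnesses \<open>s\<close> and \<open>r\<close> and a neighbour \<open>p\<close> of
  \<open>r\<close> in \<open>Q\<close> give the 7-hole \<open>s\<close>, \<open>x\<close>,
  \<open>y\<close>, \<open>w\<close>, \<open>r\<close>, \<open>p\<close>, \<open>v\<close>.
  Triangles keep \<open>p\<close> away from \<open>a\<close>; since all neighbours in
  \<open>Q\<close> of a vertex of \<open>D\<close> see \<open>a\<close>, no vertex of
  \<open>D\<close> sees \<open>p\<close>.\<close>

lemma cap_bipartite:
  assumes "finite D"
    and Q: "\<And>s. s \<in> Q \<Longrightarrow> adj v s"
    and A: "\<And>r. r \<in> A \<Longrightarrow> adj a r" "\<And>r. r \<in> A \<Longrightarrow> \<not> adj v r"
      "\<And>r. r \<in> A \<Longrightarrow> \<exists>p\<in>Q. adj p r"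
    and D: "\<And>y. y \<in> D \<Longrightarrow> \<not> adj v y"
      "\<And>y. y \<in> D \<Longrightarrow> \<exists>s\<in>Q. adj s y" "\<And>y s. y \<in> D \<Longrightarrow> s \<in> Q \<Longrightarrow> adj s y \<Longrightarrow> adj a s"
      "\<And>y. y \<in> D \<Longrightarrow> \<exists>r\<in>A. adj r y"
  shows "col D 2"
proof (rule bipartite_if_P3_rule[where S = "\<lambda>y. {s \<in> Q. adj s y}" and B = "\<lambda>y. {r \<in> A. adj r y}"])
  fix x y w
  assume xyw: "x \<in> D" "y \<in> D" "w \<in> D" "adj x y" "adj y w" "\<not> adj x w"
  show "{s \<in> Q. adj s x} \<subseteq> {s \<in> Q. adj s w} \<or> {r \<in> A. adj r w} \<subseteq> {r \<in> A. adj r x}"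
  proof (rule ccontr)
    assume "\<not> ?thesis"
    then obtain s r where s: "s \<in> Q" "adj s x" "\<not> adj s w" and r: "r \<in> A" "adj r w" "\<not> adj r x"
      by blast
    obtain p where p: "p \<in> Q" "adj p r" using A(3)[OF r(1)] by blast
    have "\<not> adj a p" using no_triangle[of a r p] A(1)[OF r(1)] p(2) adj_sym by blast
    then have pD: "\<not> adj u p" if "u \<in> D" for u using D(3)[OF that p(1)] adj_sym that by blast
    have sr: "\<not> adj s r" using no_triangle[of s a r] D(3)[OF xyw(1) s(1,2)] A(1)[OF r(1)] adj_sym by blast
    have sp: "\<not> adj s p" using no_triangle[of s v p] Q[OF s(1)] Q[OF p(1)] adj_sym by blast
    show False
    proof (rule no_7_hole[of s x y w r p v])
      show "adj w r" "adj r p" "adj p v" "adj v s"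
        using r p Q s adj_sym by blast+
      show "\<not> adj s y" using no_triangle s xyw by blast
      show "\<not> adj y r" using no_triangle[of y w r] r xyw adj_sym by blast
      show "\<not> adj x r" "\<not> adj x v" "\<not> adj y v" "\<not> adj w v" "\<not> adj r v"
        using r A(2)[OF r(1)] D(1)[OF xyw(1)] D(1)[OF xyw(2)] D(1)[OF xyw(3)] xyw by (simp_all add: adj_commute)
    qed (use s xyw sr sp pD in simp_all)
  qed
qed (use assms(1) D(2,4) in blast)+

text \<open>This is the only chord that the 7-cycle \<open>s\<close>, \<open>y\<close>,
  \<open>y'\<close>, \<open>r\<close>, \<open>a\<close>, \<open>z\<close>, \<open>v\<close> can
  have; the others are excluded by the hypotheses or by triangles.\<close>

lemma edge_rule:
  assumes "adj s y" "adj y y'" "adj r y'" "adj a r" "adj a z" "adj v z" "adj v s" "\<not> adj s a"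
    and "\<not> adj z y" "\<not> adj z y'" "\<not> adj a y" "\<not> adj a y'" "\<not> adj v y" "\<not> adj v y'" "\<not> adj v a"
    "\<not> adj v r"
  shows "adj s r"
proof (rule ccontr)
  assume *: "\<not> adj s r"
  have t: "\<not> adj s y'" "\<not> adj y r" "\<not> adj s z" "\<not> adj r z"
    using no_triangle[of s y y'] no_triangle[of y y' r] no_triangle[of s v z] no_triangle[of r a z]
      assms adj_sym[of r y'] adj_sym[of v s] adj_sym[of a r] by blast+
  show False
    by (rule no_7_hole[of s y y' r a z v]) (use assms t * in \<open>simp_all add: adj_commute\<close>)
qed

text \<open>The bound is 2 + 2 + 1 + 1 + 2. Vertices whose hubs in \<open>Q0\<close>, or whose hubs
  in \<open>A\<close>, are all adjacent to \<open>b\<close> fall under \<open>cap_bipartite\<close>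
  with root \<open>v\<close> or \<open>a\<close>. The neighbours of \<open>r0\<close> and of
  \<open>p\<close> are stable sets, and removing them keeps the return routes through
  \<open>r0\<close> and \<open>p\<close> chordless for the part that remains.\<close>

lemma triple_cover:
  assumes "finite D"
    and Q: "\<And>s. s \<in> Q \<Longrightarrow> adj v s" and A: "\<And>r. r \<in> A \<Longrightarrow> adj a r" "\<And>r. r \<in> A \<Longrightarrow> \<not> adj v r"
      "\<And>r. r \<in> A \<Longrightarrow> \<exists>p\<in>Q. adj p r"
    and z: "z \<in> Q" "adj a z" and va: "\<not> adj v a"
    and D: "\<And>y. y \<in> D \<Longrightarrow> \<not> adj v y" "\<And>y. y \<in> D \<Longrightarrow> \<not> adj a y" "\<And>y. y \<in> D \<Longrightarrow> \<not> adj z y"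
      "\<And>y. y \<in> D \<Longrightarrow> \<exists>s\<in>Q. adj s y \<and> \<not> adj s a" "\<And>y. y \<in> D \<Longrightarrow> \<exists>r\<in>A. adj r y"
    and b: "b \<in> D"
  shows "col (N2 D b) 8"
proof -
  define Q0 where "Q0 = {s \<in> Q. \<not> adj s a}"
  define B where "B = {y \<in> D. adj b y}"
  have B: "r \<in> D" "adj b r" if "r \<in> B" for r using that by (auto simp: B_def)
  have N: "y \<in> D" "\<not> adj b y" "\<exists>r\<in>B. adj r y" if "y \<in> N2 D b" for y
    using that by (auto simp: N2_def B_def)
  have Q0_D: "\<exists>s\<in>Q0. adj s y" if "y \<in> D" for y using D(4)[OF that] by (auto simp: Q0_def)
  obtain r0 where r0: "r0 \<in> A" "adj r0 b" using D(5)[OF b] by blast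
  obtain p where p: "p \<in> Q" "adj p r0" using A(3)[OF r0(1)] by blast
  define X1 where "X1 = {y \<in> N2 D b. \<forall>s\<in>Q0. adj s y \<longrightarrow> adj b s}"
  define X2 where "X2 = {y \<in> N2 D b. \<forall>r\<in>A. adj r y \<longrightarrow> adj b r}"
  define X3 where "X3 = {y \<in> N2 D b. adj r0 y}"
  define X4 where "X4 = {y \<in> N2 D b. adj p y}"
  define X5 where "X5 = N2 D b - (X1 \<union> X2 \<union> X3 \<union> X4)"
  have fin: "finite (N2 D b)" using assms(1) N2_subset finite_subset by blast
  have 1: "col X1 2"
  proof (rule cap_bipartite[of _ Q0 v B b])
    show "\<exists>p\<in>Q0. adj p r" if "r \<in> B" for r using Q0_D[OF B(1)[OF that]] .
    show "\<not> adj v r" if "r \<in> B" for r using D(1)[OF B(1)[OF that]] .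
    show "\<exists>s\<in>Q0. adj s y" if "y \<in> X1" for y using Q0_D N(1) that by (auto simp: X1_def)
  qed (use fin Q D(1) N B in \<open>auto simp: X1_def Q0_def\<close>)
  have 2: "col X2 2"
  proof (rule cap_bipartite[of _ A a B b])
    show "\<exists>p\<in>A. adj p r" if "r \<in> B" for r using D(5)[OF B(1)[OF that]] .
    show "\<not> adj a r" if "r \<in> B" for r using D(2)[OF B(1)[OF that]] .
    show "\<exists>s\<in>A. adj s y" if "y \<in> X2" for y using D(5) N(1) that by (auto simp: X2_def)
  qed (use fin A(1) D(2) N B in \<open>auto simp: X2_def\<close>)
  have 3: "col X3 1" "col X4 1" unfolding X3_def X4_def by (rule neighbours_stable)+
  have "X5 \<subseteq> N2 D b" by (auto simp: X5_def)
  then have fin5: "finite X5" using fin finite_subset by blast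
  have X5: "y \<in> N2 D b" "\<exists>s\<in>Q0. adj s y \<and> \<not> adj b s" "\<exists>r\<in>A. adj r y \<and> \<not> adj b r"
    "\<not> adj r0 y" "\<not> adj p y" if "y \<in> X5" for y
    using that by (auto simp: X1_def X2_def X3_def X4_def X5_def)
  have 5: "col X5 2"
  proof (rule bipartite_if_P3_rule[where S = "\<lambda>y. {s \<in> Q0. adj s y \<and> \<not> adj b s}"
        and B = "\<lambda>y. {r \<in> B. adj r y}"])
    fix x y w
    assume xyw: "x \<in> X5" "y \<in> X5" "w \<in> X5" "adj x y" "adj y w" "\<not> adj x w"
    note x = X5[OF xyw(1)] N[OF X5(1)[OF xyw(1)]] and y = X5[OF xyw(2)] N[OF X5(1)[OF xyw(2)]]
      and w = X5[OF xyw(3)] N[OF X5(1)[OF xyw(3)]]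
    show "{s \<in> Q0. adj s x \<and> \<not> adj b s} \<subseteq> {s \<in> Q0. adj s w \<and> \<not> adj b s} \<or>
      {r \<in> B. adj r w} \<subseteq> {r \<in> B. adj r x}"
    proof (rule ccontr)
      assume "\<not> ?thesis"
      then obtain s t where s: "s \<in> Q0" "adj s x" "\<not> adj b s" "\<not> adj s w"
        and t: "t \<in> B" "adj t w" "\<not> adj t x"
        by blast
      have sQ: "s \<in> Q" "\<not> adj s a" using s(1) by (auto simp: Q0_def)
      have tD: "t \<in> D" "adj b t" using B t(1) by auto
      \<comment> \<open>A hub \<open>r\<close> of the middle vertex is forced by
        \<open>edge_rule\<close> to be adjacent to both \<open>s\<close> and \<open>t\<close>, which
        makes \<open>s\<close> and \<open>t\<close> non-adjacent.\<close>
      obtain r where r: "r \<in> A" "adj r y" "\<not> adj b r" using y(3) by blast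
      have "adj s r"
        by (rule edge_rule[of s x y r a z v])
          (use s r xyw A(1,2)[OF r(1)] Q[OF sQ(1)] Q[OF z(1)] z va sQ D(1-3)[OF x(6)] D(1-3)[OF y(6)] in auto)
      moreover have "adj r t"
        by (rule edge_rule[of r y w t b r0 a])
          (use r t xyw A(1)[OF r(1)] A(1)[OF r0(1)] r0 tD D(2)[OF y(6)] D(2)[OF w(6)] D(2)[OF b] D(2)[OF tD(1)]
              b y w in \<open>simp_all add: adj_commute\<close>)
      ultimately have st: "\<not> adj s t" using no_triangle by blast
      have sy: "\<not> adj s y" using no_triangle s(2) xyw(4) by blast
      have yt: "\<not> adj y t" using no_triangle[of y w t] xyw(5) t(2) adj_sym by blast
      have tr0: "\<not> adj t r0" using no_triangle[of t b r0] tD r0(2) adj_sym by blast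
      have sp: "\<not> adj s p" using no_triangle[of s v p] Q sQ(1) p(1) adj_sym by blast
      have pb: "\<not> adj p b" using no_triangle[of p r0 b] p(2) r0(2) by blast
      \<comment> \<open>The path \<open>s\<close>, \<open>x\<close>, \<open>y\<close>,
        \<open>w\<close>, \<open>t\<close> closes to a 7-hole through \<open>b\<close>,
        \<open>r0\<close> or through \<open>p\<close>, \<open>v\<close> if the needed edge is there,
        and otherwise to a 9-hole through \<open>b\<close>, \<open>r0\<close>, \<open>p\<close>,
        \<open>v\<close>.\<close>
      consider "adj s r0" | "\<not> adj s r0" "adj t p" | "\<not> adj s r0" "\<not> adj t p" by blast
      then show False
      proof cases
        case 1
        show False
          by (rule no_7_hole[of s x y w t b r0])
            (use 1 s t r0 tD xyw st sy yt tr0 x y w in \<open>simp_all add: adj_commute\<close>)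
      next
        case 2
        show False
          by (rule no_7_hole[of s x y w t p v])
            (use 2 s t p tD xyw st sy yt sp x y w D(1)[OF x(6)] D(1)[OF y(6)]
              D(1)[OF w(6)] D(1)[OF tD(1)] Q[OF sQ(1)] Q[OF p(1)] in \<open>simp_all add: adj_commute\<close>)
      next
        case 3
        show False
          by (rule no_9_hole[of s x y w t b r0 p v])
            (use 3 s t p r0 tD xyw st sy yt sp pb tr0 x y w D(1)[OF x(6)] D(1)[OF y(6)]
              D(1)[OF w(6)] D(1)[OF tD(1)] D(1)[OF b] A(2)[OF r0(1)] Q[OF sQ(1)] Q[OF p(1)] in
              \<open>simp_all add: adj_commute\<close>)
      qed
    qed
  qed (use fin5 X5 N in blast)+
  have "col (X1 \<union> X2 \<union> (X3 \<union> X4) \<union> X5) (2 + 2 + (1 + 1) + 2)"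
    by (intro col_Un 1 2 3 5)
  then show ?thesis by (rule col_mono) (auto simp: X5_def)
qed

end

section \<open>Parity of paths through the upper levels\<close>

text \<open>\<open>R\<close>, \<open>Q\<close>, \<open>C\<close> are three consecutive levels of a breadth-first search and \<open>U\<close> is the union of
  the earlier ones. \<open>Y\<close> is what remains of a component of \<open>C\<close> after the neighbours of \<open>q0\<close> and then
  of \<open>t\<close> are deleted.\<close>

locale levels = pentagonal_graph adj for adj :: "'a \<Rightarrow> 'a \<Rightarrow> bool" +
  fixes X U R Q C :: "'a set" and k :: nat
  assumes finite_X: "finite X" and sub_X: "U \<union> R \<union> Q \<union> C \<subseteq> X"
    and N2_col: "\<And>x. x \<in> X \<Longrightarrow> col (N2 X x) k"
    and disj: "U \<inter> Q = {}" "U \<inter> C = {}" "R \<inter> Q = {}" "R \<inter> C = {}" "Q \<inter> C = {}"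
    and U_conn: "conn U"
    and R_U: "\<And>r. r \<in> R \<Longrightarrow> \<exists>u\<in>U. adj r u"
    and Q_R: "\<And>q. q \<in> Q \<Longrightarrow> \<exists>r\<in>R. adj q r"
    and C_Q: "\<And>y. y \<in> C \<Longrightarrow> \<exists>q\<in>Q. adj q y"
    and UR_C: "\<And>u y. u \<in> U \<union> R \<Longrightarrow> y \<in> C \<Longrightarrow> \<not> adj u y"
    and U_Q: "\<And>u q. u \<in> U \<Longrightarrow> q \<in> Q \<Longrightarrow> \<not> adj u q"

locale rooted_levels = levels +
  fixes Y :: "'a set" and q0 r0 t c :: 'a
  assumes q0: "q0 \<in> Q" and r0: "r0 \<in> R" "adj q0 r0"
    and t: "t \<in> C" "adj q0 t" and c: "c \<in> C" "adj t c" and Y_C: "Y \<subseteq> C" and Y_conn: "conn (insert c Y)"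
    and q0_Y: "\<And>y. y \<in> Y \<Longrightarrow> \<not> adj q0 y" and t_Y: "\<And>y. y \<in> Y \<Longrightarrow> \<not> adj t y"
begin

text \<open>The hubs that see none of the root vertices \<open>t\<close>, \<open>c\<close>,
  \<open>q0\<close>, \<open>r0\<close>, so that ending a path in one of them creates no chord near
  the root. Vertices of \<open>Y\<close> with a parent outside \<open>H\<close> are paid for by
  \<open>4 * k\<close> colours in \<open>col_Y\<close>.\<close>

definition H :: "'a set" where
  "H = {q \<in> Q. \<not> adj q t \<and> \<not> adj q c \<and> \<not> adj q q0 \<and> \<not> adj q r0 \<and> (\<exists>y\<in>Y. adj q y)}"

lemma H: "q \<in> H \<Longrightarrow> q \<in> Q" "q \<in> H \<Longrightarrow> \<not> adj q t" "q \<in> H \<Longrightarrow> \<not> adj q c" "q \<in> H \<Longrightarrow> \<not> adj q q0"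
  "q \<in> H \<Longrightarrow> \<not> adj q r0" "q \<in> H \<Longrightarrow> \<exists>y\<in>Y. adj q y" "q \<in> H \<Longrightarrow> q \<noteq> q0"
  using t by (auto simp: H_def)

lemma q0_c: "\<not> adj q0 c"
  using no_triangle t(2) c(2) by blast

text \<open>The parity of an induced path from \<open>q0\<close> to a hub \<open>q\<close> through \<open>U \<union> R\<close> does not depend on the
  path: all of them close up with the same path from \<open>q0\<close> through \<open>t\<close>, \<open>c\<close> and \<open>Y\<close> to a hole of
  length at least six.\<close>

lemma parity_exists:
  assumes "q \<in> H"
  shows "\<exists>b. \<forall>us. us \<noteq> [] \<and> set us \<subseteq> U \<union> R \<and> ipath (q0 # us @ [q]) \<longrightarrow> (even (length us) \<longleftrightarrow> b)"
proof -
  define J where "J = insert t (insert c Y)"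
  have J: "conn J" unfolding J_def by (rule conn_insert[OF Y_conn, of c]) (use c in auto)
  have JC: "J \<subseteq> C" using t(1) c(1) Y_C by (auto simp: J_def)
  obtain y where y: "y \<in> Y" "adj q y" using H(6)[OF assms] by blast
  have "reach J t y" using J y(1) by (simp add: conn_def J_def)
  then obtain xs z where z: "ipath (xs @ [z])" "hd (xs @ [z]) = t" "adj q z" "set (xs @ [z]) \<subseteq> J"
    "\<forall>u\<in>set xs. \<not> adj q u"
    using first_hit[of J t y "{u. adj q u}" thesis] y(2) by (auto simp: J_def)
  have ne: "xs \<noteq> []" using z(2,3) H(2)[OF assms] by auto
  then obtain xs' where xs: "xs = t # xs'" using z(2) by (cases xs) auto
  have "xs' \<noteq> []"
  proof
    assume "xs' = []"
    then have "adj t z" "z \<in> J" using z(1,4) xs by auto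
    then show False
      using z(3) H(3)[OF assms] t_Y adj_irrefl by (auto simp: J_def)
  qed
  \<comment> \<open>With \<open>q0\<close>, \<open>q\<close> and at least one vertex of
    \<open>us\<close>, the hole gets at least 3 + 2 + 1 vertices, beyond the exceptional length
    five.\<close>
  then have len: "length (xs @ [z]) \<ge> 3" using xs by (cases xs') auto
  have "even (length us) \<longleftrightarrow> even (length (xs @ [z]))"
    if us: "us \<noteq> []" "set us \<subseteq> U \<union> R" "ipath (q0 # us @ [q])" for us
  proof -
    have "even (length (xs @ [z]) + length (rev (q0 # us @ [q]))) \<or>
        length (xs @ [z]) + length (rev (q0 # us @ [q])) = 5"
    proof (rule hole_parity)
      show "ipath (rev (q0 # us @ [q]))" using us(3) unfolding ipath_rev .
      fix x y assume xy: "x \<in> set (xs @ [z])" "y \<in> set (rev (q0 # us @ [q]))"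
      have xJ: "x \<in> J" using xy(1) z(4) by blast
      then have xC: "x \<in> C" using JC by blast
      have "y = q0 \<or> y = q \<or> y \<in> U \<union> R" using xy(2) us(2) by auto
      then show "x \<noteq> y \<and> (adj x y \<longrightarrow> (x = last (xs @ [z]) \<and> y = hd (rev (q0 # us @ [q]))) \<or>
          (x = hd (xs @ [z]) \<and> y = last (rev (q0 # us @ [q]))))"
      proof (elim disjE)
        assume y: "y = q0"
        have "adj x q0 \<Longrightarrow> x = t" using xJ q0_c q0_Y[of x] by (auto simp: J_def adj_commute)
        then show ?thesis using y z(2) xC disj q0 by auto
      next
        assume y: "y = q"
        have "adj x q \<Longrightarrow> x = z" using xy(1) z(5) by (auto simp: adj_commute)
        then show ?thesis using y xC disj H(1)[OF assms] by auto
      next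
        assume y: "y \<in> U \<union> R"
        then show ?thesis using xC disj UR_C[OF y xC] by (auto simp: adj_commute)
      qed
    qed (use z us(1) len t(2) in \<open>simp_all add: adj_commute\<close>)
    moreover have "length us \<ge> 1" using us(1) by (cases us) auto
    ultimately show ?thesis using len by auto
  qed
  then show ?thesis by blast
qed

text \<open>Inner vertices are counted, so \<open>True\<close> stands for paths with an odd number
  of edges.\<close>

definition rho :: "'a \<Rightarrow> bool" where
  "rho q = (SOME b. \<forall>us. us \<noteq> [] \<and> set us \<subseteq> U \<union> R \<and> ipath (q0 # us @ [q]) \<longrightarrow> (even (length us) \<longleftrightarrow> b))"

lemma rho:
  assumes "q \<in> H" "us \<noteq> []" "set us \<subseteq> U \<union> R" "ipath (q0 # us @ [q])"
  shows "even (length us) \<longleftrightarrow> rho q"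
  using someI_ex[OF parity_exists[OF assms(1)]] assms(2-4) unfolding rho_def by blast

text \<open>The lower and the upper path from \<open>q\<close> to \<open>p\<close> form a hole with
  at least 3 + 1 + 2 vertices, hence an even one. The upper path may use \<open>q0\<close>, which
  sees nothing in \<open>Y\<close>, because the detour in \<open>parity_of_Y_path\<close> can pass
  through it.\<close>

lemma parity_closing:
  assumes "q \<in> H" "p \<in> H" "set cs \<subseteq> Y" "ipath (q # cs @ [p])" "length cs \<ge> 3"
    and us: "us \<noteq> []" "set us \<subseteq> insert q0 (U \<union> R)" "ipath (q # us @ [p])"
  shows "even (length cs) \<longleftrightarrow> even (length us)"
proof -
  have ne: "cs \<noteq> []" using assms(5) by auto
  have i: "ipath (cs @ [p])" using assms(4) ipath_appendD(2)[of "[q]" "cs @ [p]"] by simp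
  have "even (length cs + length (rev (q # us @ [p]))) \<or> length cs + length (rev (q # us @ [p])) = 5"
  proof (rule hole_parity)
    show "ipath cs" using i ipath_appendD(1) by blast
    show "ipath (rev (q # us @ [p]))" using us(3) unfolding ipath_rev .
    show "adj (last cs) (hd (rev (q # us @ [p])))" using i ne by (simp add: ipath_snoc)
    show "adj (last (rev (q # us @ [p]))) (hd cs)" using assms(4) ne by (auto simp: ipath_Cons)
    fix x y assume xy: "x \<in> set cs" "y \<in> set (rev (q # us @ [p]))"
    have xY: "x \<in> Y" "x \<in> C" using xy(1) assms(3) Y_C by auto
    have "y = q \<or> y = p \<or> y = q0 \<or> y \<in> U \<union> R" using xy(2) us(2) by auto
    then show "x \<noteq> y \<and> (adj x y \<longrightarrow> (x = last cs \<and> y = hd (rev (q # us @ [p]))) \<or>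
        (x = hd cs \<and> y = last (rev (q # us @ [p]))))"
    proof (elim disjE)
      assume y: "y = q"
      have "\<forall>u\<in>set (cs @ [p]). q \<noteq> u \<and> (adj q u \<longrightarrow> u = hd (cs @ [p]))"
        using assms(4) by (simp add: ipath_Cons[of q])
      then show ?thesis using y xy(1) ne by (auto simp: adj_commute)
    next
      assume y: "y = p"
      show ?thesis using y xy(1) ne i by (auto simp: ipath_snoc adj_commute)
    next
      assume "y = q0"
      then show ?thesis using q0_Y[OF xY(1)] xY(2) q0 disj by (auto simp: adj_commute)
    next
      assume y: "y \<in> U \<union> R"
      then show ?thesis using UR_C[OF y xY(2)] xY(2) disj by (auto simp: adj_commute)
    qed
  qed (use assms ne in simp_all)
  then show ?thesis using assms(5) us(1) by (cases us) auto
qed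

text \<open>By \<open>parity_closing\<close> a single upper path from \<open>q\<close> to
  \<open>p\<close> decides the parity of all lower ones, so it suffices to build one that can be
  compared with paths from \<open>q0\<close>. A common parent is such a path. Otherwise, a path
  between two parents is joined to \<open>q0\<close> by a stem; following the stem and then either
  branch realises \<open>rho q\<close> and \<open>rho p\<close>.\<close>

lemma parity_of_Y_path:
  assumes q: "q \<in> H" and p: "p \<in> H" and qp: "q \<noteq> p" "\<not> adj q p"
    and cs: "set cs \<subseteq> Y" "ipath (q # cs @ [p])" "length cs \<ge> 3"
  shows "even (length cs) \<longleftrightarrow> rho q \<noteq> rho p"
proof (cases "\<exists>r\<in>R. adj q r \<and> adj p r")
  case True
  then obtain r where r: "r \<in> R" "adj q r" "adj p r" by blast
  have "ipath (q # [r] @ [p])" using r qp by (auto simp: adj_commute)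
  then have odd: "odd (length cs)" using parity_closing[OF q p cs, of "[r]"] r(1) by simp
  define J where "J = insert q0 (insert r0 (insert r U))"
  have "conn (insert r U)" using conn_insert[OF U_conn] R_U[OF r(1)] by blast
  then have "conn (insert r0 (insert r U))" using conn_insert R_U[OF r0(1)] by blast
  then have J: "conn J" unfolding J_def using conn_insert r0(2) by blast
  have "r \<noteq> q0" using r(1) q0 disj by auto
  have "reach J q0 r" using J by (simp add: conn_def J_def)
  then obtain zs where zs: "zs \<noteq> []" "ipath zs" "hd zs = q0" "last zs = r" "set zs \<subseteq> J"
    using ipath_exists[of J q0 r] by (auto simp: J_def)
  then obtain vs where vs: "zs = q0 # vs" by (cases zs) auto
  have vne: "vs \<noteq> []" using vs zs(4) \<open>r \<noteq> q0\<close> by auto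
  have last: "last vs = r" using vs zs(4) vne by simp
  have sub: "set vs \<subseteq> U \<union> R"
    using ipath_distinct[OF zs(2)] zs(5) vs r(1) r0(1) by (auto simp: J_def)
  \<comment> \<open>The same path from \<open>q0\<close> to \<open>r\<close> extends to both hubs,
    since a hub in \<open>H\<close> sees neither \<open>q0\<close>, nor \<open>r0\<close>, nor
    \<open>U\<close>. Hence their parities agree.\<close>
  have "ipath (q0 # vs @ [h])" if h: "h \<in> H" "adj h r" for h
  proof -
    have "h \<noteq> u \<and> (adj h u \<longrightarrow> u = r)" if "u \<in> set zs" for u
      using that zs(5) H[OF h(1)] U_Q[of u h] disj r(1) r0(1) by (auto simp: J_def adj_commute)
    then have "ipath (zs @ [h])" using zs h(2) by (simp add: ipath_snoc adj_commute)
    then show ?thesis using vs by simp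
  qed
  then have "rho q = rho p" using rho[OF q vne sub] rho[OF p vne sub] r q p by blast
  then show ?thesis using odd by simp
next
  case False
  obtain rq where rq: "rq \<in> R" "adj q rq" using Q_R H(1)[OF q] by blast
  obtain rp where rp: "rp \<in> R" "adj p rp" using Q_R H(1)[OF p] by blast
  have nadj: "\<not> adj q rp" "\<not> adj p rq" using False rq rp by auto
  define J where "J = insert rq (insert rp U)"
  have "conn (insert rp U)" using conn_insert[OF U_conn] R_U[OF rp(1)] by blast
  then have J: "conn J" unfolding J_def using conn_insert R_U[OF rq(1)] by blast
  have "reach J rq rp" using J by (simp add: conn_def J_def)
  then obtain us where us: "us \<noteq> []" "ipath us" "hd us = rq" "last us = rp" "set us \<subseteq> J"
    using ipath_exists[of J rq rp] by (auto simp: J_def)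
  have usUR: "set us \<subseteq> U \<union> R" using us(5) rq(1) rp(1) by (auto simp: J_def)
  have qu: "q \<noteq> u" "adj q u \<Longrightarrow> u = rq" and pu: "p \<noteq> u" "adj p u \<Longrightarrow> u = rp" if "u \<in> set us" for u
    using that us(5) H(1)[OF q] H(1)[OF p] U_Q[of u q] U_Q[of u p] disj rq(1) rp(1) nadj
    by (auto simp: J_def adj_commute)
  have "ipath (us @ [p])" using us pu rp by (auto simp: ipath_snoc adj_commute)
  then have i: "ipath (q # us @ [p])"
    using us qu rq qp by (auto simp: ipath_Cons[of q])
  have rus: "rq \<in> set us" "rp \<in> set us" using us by auto
  define S where "S = insert q0 (insert r0 J)"
  have "\<exists>u\<in>J. adj r0 u" using R_U[OF r0(1)] by (auto simp: J_def)
  then have "conn (insert r0 J)" using conn_insert[OF J] by blast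
  then have "conn S" unfolding S_def using conn_insert r0(2) by blast
  then have "reach S q0 rq" by (simp add: conn_def S_def J_def)
  \<comment> \<open>The stem stops at its first contact with the closed neighbourhood of
    \<open>us\<close>, so \<open>s\<close> is its only vertex with neighbours on \<open>us\<close>.
    Possibly \<open>s\<close> is \<open>q0\<close> itself.\<close>
  then obtain ss s where ss: "ipath (ss @ [s])" "hd (ss @ [s]) = q0"
    "s \<in> set us \<or> (\<exists>w\<in>set us. adj s w)" "set (ss @ [s]) \<subseteq> S"
    "\<forall>u\<in>set ss. u \<notin> set us \<and> (\<forall>w\<in>set us. \<not> adj u w)"
    using first_hit[of S q0 rq "{x. x \<in> set us \<or> (\<exists>w\<in>set us. adj x w)}" thesis] rus
    by (auto simp: S_def)
  have s_us: "s \<notin> set us"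
  proof
    assume s: "s \<in> set us"
    show False
    proof (cases "ss = []")
      case True
      then show False using s ss(2) usUR q0 disj by auto
    next
      case False
      then show False using s ss(1,5) last_in_set[OF False] by (auto simp: ipath_snoc)
    qed
  qed
  then have s_adj: "\<exists>w\<in>set us. adj s w" using ss(3) by blast
  have ssS: "u \<in> insert q0 (insert r0 U)" "u \<notin> set us" if "u \<in> set (ss @ [s])" for u
    using that ss(4,5) s_us rus by (auto simp: S_def J_def)
  have ssH: "h \<noteq> u" "\<not> adj u h" if "u \<in> set (ss @ [s])" "h \<in> H" for u h
    using ssS(1)[OF that(1)] H[OF that(2)] U_Q[of u h] disj r0(1) by (auto simp: adj_commute)
  obtain vs where vs: "ss @ [s] = q0 # vs" using ss(2) by (cases "ss @ [s]") auto
  have vsUR: "set vs \<subseteq> U \<union> R"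
    using ssS(1) vs ipath_distinct[OF ss(1)] r0(1) by fastforce
  have lvs: "length vs = length ss" using arg_cong[OF vs, of length] by simp
  obtain as w bs where w: "us = as @ w # bs" "adj s w" "\<forall>u\<in>set as. \<not> adj s u"
    using split_list_first_prop[of us "adj s"] s_adj by blast
  obtain as' w' bs' where w': "us = as' @ w' # bs'" "adj s w'" "\<forall>u\<in>set bs'. \<not> adj s u"
    using split_list_last_prop[of us "adj s"] s_adj by blast
  have cross: "x \<noteq> y \<and> (adj x y \<longrightarrow> x = s \<and> y = v)"
    if xy: "x \<in> set (ss @ [s])" "y = h \<or> y \<in> T" and T: "h \<in> H" "T \<subseteq> set us" "\<forall>u\<in>T - {v}. \<not> adj s u"
    for x y h v T
  proof (cases "y = h")
    case True
    then show ?thesis using ssH[OF xy(1) T(1)] by auto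
  next
    case False
    then have y: "y \<in> T" "y \<in> set us" using xy(2) T(2) by auto
    have "x = s" if "adj x y"
    proof (rule ccontr)
      assume "x \<noteq> s"
      then have "x \<in> set ss" using xy(1) by simp
      then show False using ss(5) y(2) that by blast
    qed
    then show ?thesis using ssS(2)[OF xy(1)] y T(3) by blast
  qed
  have "ipath ((ss @ [s]) @ (w # rev as @ [q]))"
  proof (rule ipath_appendI[where a = s and b = w])
    have "ipath (q # as @ [w])"
      using i ipath_appendD(1)[of "q # as @ [w]" "bs @ [p]"] w(1) by simp
    then show "ipath (w # rev as @ [q])" using ipath_rev[of "q # as @ [w]"] by simp
    show "x \<noteq> y \<and> (adj x y \<longrightarrow> x = s \<and> y = w)"
      if "x \<in> set (ss @ [s])" "y \<in> set (w # rev as @ [q])" for x y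
      by (rule cross[OF that(1) _ q, of _ "set (w # as)"]) (use that(2) w in auto)
  qed (use ss(1) w(2) in simp_all)
  then have "ipath (q0 # (vs @ w # rev as) @ [q])" using vs by simp
  then have rq: "rho q \<longleftrightarrow> even (length ss + length as + 1)"
    using rho[OF q, of "vs @ w # rev as"] vsUR usUR w(1) lvs by auto
  have "ipath ((ss @ [s]) @ (w' # bs' @ [p]))"
  proof (rule ipath_appendI[where a = s and b = w'])
    show "ipath (w' # bs' @ [p])"
      using i ipath_appendD(2)[of "q # as'" "w' # bs' @ [p]"] w'(1) by simp
    show "x \<noteq> y \<and> (adj x y \<longrightarrow> x = s \<and> y = w')"
      if "x \<in> set (ss @ [s])" "y \<in> set (w' # bs' @ [p])" for x y
      by (rule cross[OF that(1) _ p, of _ "set (w' # bs')"]) (use that(2) w' in auto)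
  qed (use ss(1) w'(2) in simp_all)
  then have "ipath (q0 # (vs @ w' # bs') @ [p])" using vs by simp
  then have rp: "rho p \<longleftrightarrow> even (length ss + length bs' + 1)"
    using rho[OF p, of "vs @ w' # bs'"] vsUR usUR w'(1) lvs by auto
  \<comment> \<open>The two extended stems differ in length only by \<open>as\<close> against
    \<open>bs'\<close>. If \<open>s\<close> has one neighbour on \<open>us\<close>, then
    \<open>us\<close> itself has the stated length. If it has several, replacing the stretch between
    the first and the last by \<open>s\<close> gives two vertices more; that stretch is non-empty
    because \<open>s\<close>, \<open>w\<close>, \<open>w'\<close> form no triangle.\<close>
  have "even (length cs) \<longleftrightarrow> even (length as + length bs' + 1)"
  proof (cases "length as = length as'")
    case True
    then have "as = as'" "bs = bs'" using w(1) w'(1) by auto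
    then have "length us = length as + length bs' + 1" using w(1) by simp
    then show ?thesis using parity_closing[OF q p cs us(1) _ i] usUR by auto
  next
    case False
    have "length as \<le> length as'"
    proof (rule ccontr)
      assume l: "\<not> length as \<le> length as'"
      then have "w' = as ! length as'" using w(1) w'(1) by (metis nth_append nth_append_length not_le)
      then show False using l w(3) w'(2) by auto
    qed
    then have lt: "length as < length as'" using False by simp
    have "take (length as) as' = as" "drop (length as) as' = w # drop (Suc (length as)) as'"
    proof -
      have "take (length as) us = take (length as) as'" using w'(1) lt by simp
      then show "take (length as) as' = as" using w(1) by simp
      have "as' ! length as = w" using w(1) w'(1) lt by (metis nth_append nth_append_length)
      then show "drop (length as) as' = w # drop (Suc (length as)) as'" using lt Cons_nth_drop_Suc by metis
    qed
    then obtain mid where mid: "as' = as @ w # mid" using append_take_drop_id by metis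
    have i2: "ipath ((q # as @ [w]) @ (mid @ w' # bs' @ [p]))" using i w'(1) mid by simp
    have "mid \<noteq> []"
    proof
      assume "mid = []"
      then have "adj w w'" using i2 by (subst (asm) ipath_append) auto
      then show False using no_triangle[of w s w'] w(2) w'(2) adj_sym by blast
    qed
    then have hm: "hd (mid @ w' # bs' @ [p]) = hd mid" "hd mid \<in> set mid" by auto
    have d: "distinct (mid @ w' # bs' @ [p])" using ipath_distinct[OF i2] by simp
    have cr: "x \<noteq> y \<and> \<not> adj x y" if "x \<in> set (q # as @ [w])" "y \<in> set (w' # bs' @ [p])" for x y
    proof -
      have "y \<noteq> hd mid" using d hm(2) that(2) by auto
      then show ?thesis
        using i2 that hm(1) ipath_append[of "q # as @ [w]" "mid @ w' # bs' @ [p]"] by auto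
    qed
    have sq: "\<not> adj s q" "\<not> adj s p" "s \<noteq> q" "s \<noteq> p" using ssH[of s] q p by auto
    have "ipath ((q # as @ [w]) @ (s # w' # bs' @ [p]))"
    proof (rule ipath_appendI[where a = w and b = s])
      have "ipath (w' # bs' @ [p])"
        using i ipath_appendD(2)[of "q # as'" "w' # bs' @ [p]"] w'(1) by simp
      then show "ipath (s # w' # bs' @ [p])"
        using w' s_us sq by (auto simp: ipath_Cons[of s])
      show "ipath (q # as @ [w])" using i2 ipath_appendD(1) by blast
      show "x \<noteq> y \<and> (adj x y \<longrightarrow> x = w \<and> y = s)"
        if xy: "x \<in> set (q # as @ [w])" "y \<in> set (s # w' # bs' @ [p])" for x y
      proof (cases "y = s")
        case True
        then show ?thesis using xy(1) w s_us sq by (auto simp: adj_commute)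
      next
        case False
        then show ?thesis using cr[OF xy(1), of y] xy(2) by simp
      qed
    qed (use w(2) adj_sym in simp_all)
    then have "ipath (q # (as @ w # s # w' # bs') @ [p])" by simp
    moreover have "set (as @ w # s # w' # bs') \<subseteq> insert q0 (U \<union> R)"
    proof -
      have "set (as @ [w]) \<subseteq> set us" using w(1) by auto
      moreover have "set (w' # bs') \<subseteq> set us" using w'(1) by auto
      ultimately show ?thesis using usUR ssS(1)[of s] r0(1) by auto
    qed
    ultimately have "even (length cs) \<longleftrightarrow> even (length (as @ w # s # w' # bs'))"
      using parity_closing[OF q p cs, of "as @ w # s # w' # bs'"] by simp
    then show ?thesis by simp
  qed
  then show ?thesis using rq rp by auto
qed

section \<open>Colouring the vertices whose parents are all in \<open>H\<close>\<close>

definition Yg :: "'a set" where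
  "Yg = {y \<in> Y. \<forall>q\<in>Q. adj q y \<longrightarrow> q \<in> H}"

lemma Yg_hub: "y \<in> Yg \<Longrightarrow> \<exists>q\<in>H. adj q y"
  using C_Q Y_C by (fastforce simp: Yg_def)

lemma Yg_X: "Yg \<subseteq> X" and Yg_Y: "Yg \<subseteq> Y" and H_X: "H \<subseteq> X" and H_Y: "H \<inter> Y = {}"
proof -
  show H_Y: "H \<inter> Y = {}" using Y_C H(1) disj(5) by blast
qed (use sub_X Y_C H(1) in \<open>auto simp: Yg_def\<close>)

text \<open>From \<open>q\<close> along \<open>L\<close>, one can end in \<open>p\<close> after
  \<open>e\<close>, or in \<open>p'\<close> after \<open>e\<close> and \<open>e'\<close>. The
  numbers of inner vertices differ by one, while equal \<open>rho\<close> at \<open>p\<close> and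
  \<open>p'\<close> demands equal parity. At least two vertices in \<open>L\<close> give the three
  inner vertices that \<open>parity_of_Y_path\<close> requires.\<close>

lemma no_clean_path:
  assumes hubs: "q \<in> H" "p \<in> H" "p' \<in> H" "rho p = rho p'" "q \<noteq> p" "q \<noteq> p'" "\<not> adj q p" "\<not> adj q p'"
    and e: "e \<in> Y" "e' \<in> Y" "adj e e'" "adj p e" "adj p' e'" "\<not> adj q e" "\<not> adj q e'"
    and L: "ipath L" "length L \<ge> 2" "set L \<subseteq> Y" "\<And>u. u \<in> set L \<Longrightarrow> \<not> adj p u \<and> \<not> adj p' u"
      "adj q (last L)" "\<And>u. u \<in> set L \<Longrightarrow> adj q u \<Longrightarrow> u = last L"
      "adj (hd L) e" "\<And>u. u \<in> set L \<Longrightarrow> \<not> adj u e' \<and> (adj u e \<longrightarrow> u = hd L)"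
  shows False
proof -
  have ne: "L \<noteq> []" using L(2) by auto
  have eL: "e \<notin> set L" "e' \<notin> set L" using L(4) e(4,5) by blast+
  have pe: "\<not> adj p e'" "\<not> adj p' e" using no_triangle e(3-5) adj_sym by blast+
  have neq: "h \<noteq> y" if "h \<in> H" "y \<in> Y" for h y using H_Y that by blast
  have i: "ipath (rev L)" using L(1) unfolding ipath_rev .
  have ie: "ipath (rev L @ [e])"
    unfolding ipath_snoc using i ne L(7,8) eL(1) by (auto simp: last_rev adj_commute)
  have iee: "ipath ((rev L @ [e]) @ [e'])"
    unfolding ipath_snoc[of "rev L @ [e]"]
    using ie L(8) eL(2) e(3) adjacent_ne by (auto simp: adj_commute)
  have q_path: "ipath (q # rev L @ cs)" if cs: "ipath (rev L @ cs)" "set cs \<subseteq> {e, e', p, p'}" for cs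
  proof -
    have "hd (rev L @ cs) = last L" using ne by (simp add: hd_append hd_rev)
    moreover have "q \<noteq> u \<and> (adj q u \<longrightarrow> u = last L)" if u: "u \<in> set (rev L @ cs)" for u
    proof (cases "u \<in> set L")
      case True
      then show ?thesis using L(3,6) neq[OF hubs(1)] by blast
    next
      case False
      then have "u \<in> {e, e', p, p'}" using u cs(2) by auto
      then show ?thesis using hubs(5-8) e(1,2,6,7) neq[OF hubs(1)] by blast
    qed
    ultimately show ?thesis using cs L(5) by (simp add: ipath_Cons[of q])
  qed
  have "ipath ((rev L @ [e]) @ [p])"
    unfolding ipath_snoc[of "rev L @ [e]"]
    using ie L(3,4) e(1,4) neq[OF hubs(2)] by (auto simp: adj_commute)
  then have "ipath (q # rev L @ [e, p])" by (intro q_path[of "[e, p]"]) auto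
  then have 1: "even (length L + 1) \<longleftrightarrow> rho q \<noteq> rho p"
    using parity_of_Y_path[OF hubs(1,2,5,7), of "rev L @ [e]"] L(2,3) e(1) by auto
  have "ipath (((rev L @ [e]) @ [e']) @ [p'])"
    unfolding ipath_snoc[of "(rev L @ [e]) @ [e']"]
    using iee L(3,4) e(1,2,5) pe(2) neq[OF hubs(3)] by (auto simp: adj_commute)
  then have "ipath (q # rev L @ [e, e', p'])" by (intro q_path[of "[e, e', p']"]) auto
  then have "even (length L + 2) \<longleftrightarrow> rho q \<noteq> rho p'"
    using parity_of_Y_path[OF hubs(1,3,6,8), of "rev L @ [e, e']"] L(2,3) e(1,2) by auto
  then show False using 1 hubs(4) by (cases "rho q"; cases "rho p'") auto
qed

text \<open>The children of \<open>p\<close> and \<open>p'\<close> shield an edge from every part of \<open>Yg\<close> of large chromatic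
  number: a hub seen only beyond the shield would close up with both ends of the edge.\<close>

lemma shield:
  assumes xz: "x \<in> Yg" "z \<in> Yg" "adj x z" and p: "p \<in> H" "p' \<in> H" "adj p x" "adj p' z" "rho p = rho p'"
    and K: "K \<subseteq> Yg" "conn K" "\<And>y. y \<in> K \<Longrightarrow> \<not> adj p y \<and> \<not> adj p' y" and w0: "w0 \<in> K" "adj w0 z"
  shows "col K (5 * k + 2)"
proof -
  define N where "N = {y \<in> K. adj x y} \<union> {y \<in> K. adj z y}"
  have "col N (1 + 1)" unfolding N_def by (intro col_Un neighbours_stable)
  moreover have "col (K - N) (5 * k)"
  proof (rule col_comps)
    fix y0 assume y0: "y0 \<in> K - N"
    define W where "W = comp (K - N) y0"
    have W: "conn W" "W \<subseteq> K - N" "y0 \<in> W"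
      using conn_comp comp_subset[OF y0] by (auto simp: W_def)
    have "w0 \<notin> W" using w0 W(2) by (auto simp: N_def adj_commute)
    then obtain u c' where uc: "u \<in> K" "u \<in> W" "c' \<in> K" "c' \<notin> W" "adj u c'"
      using conn_crossing[OF K(2), of y0 W w0] y0 W(3) w0(1) by blast
    have c'N: "c' \<in> N" using comp_closed[of u "K - N" y0 c'] uc y0 by (auto simp: W_def)
    have conn': "conn (insert c' W)" using conn_insert[OF W(1) uc(2)] uc(5) adj_sym by blast
    have KY: "K \<subseteq> Y" "K \<subseteq> X" using K(1) Yg_Y Yg_X by auto
    have xzK: "x \<notin> K" "z \<notin> K" using K(3) p by blast+
    have xzY: "x \<in> Y" "z \<in> Y" "x \<in> X" "z \<in> X" using xz Yg_Y Yg_X by auto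
    \<comment> \<open>Otherwise a path from \<open>c'\<close> through \<open>W\<close> to the first
      child of \<open>q\<close> contradicts \<open>no_clean_path\<close>. So every vertex of
      \<open>W\<close> is at distance two from one of five vertices, whence \<open>5 * k\<close>;
      the further 2 colours are for the neighbours of \<open>x\<close> and \<open>z\<close> in
      \<open>N\<close>.\<close>
    have hit: "adj q x \<or> adj q z \<or> adj q c' \<or> adj q p \<or> adj q p'" if q: "q \<in> H" "y \<in> W" "adj q y" for q y
    proof (rule ccontr)
      assume n: "\<not> ?thesis"
      have "q \<noteq> p" "q \<noteq> p'" using K(3) q(2,3) W(2) by blast+
      have "reach (insert c' W) c' y" using conn' q(2) by (simp add: conn_def)
      then obtain ds d where d: "ipath (ds @ [d])" "hd (ds @ [d]) = c'" "adj q d"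
        "set (ds @ [d]) \<subseteq> insert c' W" "\<forall>u\<in>set ds. \<not> adj q u"
        using first_hit[of "insert c' W" c' y "{u. adj q u}" thesis] q(3) by auto
      define L where "L = ds @ [d]"
      have "ds \<noteq> []" using d(2,3) n by auto
      then have len: "length L \<ge> 2" by (cases ds) (auto simp: L_def)
      have LK: "set L \<subseteq> K" using d(4) uc(3) W(2) by (auto simp: L_def)
      have hdL: "hd L = c'" using d(2) by (simp add: L_def)
      have LW: "u = c' \<or> u \<in> W" if "u \<in> set L" for u using d(4) that by (auto simp: L_def)
      have LN: "u = c' \<or> (\<not> adj u x \<and> \<not> adj u z)" if "u \<in> set L" for u
        using LW[OF that] W(2) by (auto simp: N_def adj_commute)
      have LY: "set L \<subseteq> Y" using LK KY by blast
      have Lp: "\<not> adj p u \<and> \<not> adj p' u" if "u \<in> set L" for u using K(3) LK that by blast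
      have Lq: "adj q (last L)" "\<And>u. u \<in> set L \<Longrightarrow> adj q u \<Longrightarrow> u = last L"
        using d(3,5) by (auto simp: L_def)
      have iL: "ipath L" using d(1) by (simp add: L_def)
      \<comment> \<open>Without triangles, \<open>c'\<close> sees exactly one end of the edge, and
        that end becomes \<open>e\<close>.\<close>
      have "adj c' x \<or> adj c' z" using c'N by (auto simp: N_def adj_commute)
      then show False
      proof
        assume a: "adj c' x"
        then have "\<not> adj c' z" using no_triangle xz(3) by blast
        show False
        proof (rule no_clean_path[OF q(1) p(1,2,5) \<open>q \<noteq> p\<close> \<open>q \<noteq> p'\<close> _ _ xzY(1,2) xz(3) p(3,4) _ _ iL len LY])
          show "\<not> adj u z \<and> (adj u x \<longrightarrow> u = hd L)" if "u \<in> set L" for u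
            using LN[OF that] \<open>\<not> adj c' z\<close> hdL by auto
        qed (use n Lp Lq a hdL in auto)
      next
        assume a: "adj c' z"
        then have "\<not> adj c' x" using no_triangle[of c' z x] adj_sym[OF xz(3)] by blast
        show False
        proof (rule no_clean_path[OF q(1) p(2,1) p(5)[symmetric] \<open>q \<noteq> p'\<close> \<open>q \<noteq> p\<close> _ _ xzY(2,1)
              adj_sym[OF xz(3)] p(4,3) _ _ iL len LY])
          show "\<not> adj u x \<and> (adj u z \<longrightarrow> u = hd L)" if "u \<in> set L" for u
            using LN[OF that] \<open>\<not> adj c' x\<close> hdL by auto
        qed (use n Lp Lq a hdL in auto)
      qed
    qed
    have "W \<subseteq> N2 X x \<union> N2 X z \<union> N2 X c' \<union> N2 X p \<union> N2 X p'"
    proof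
      fix y assume y: "y \<in> W"
      then have yK: "y \<in> K" "y \<in> X" "y \<in> Y" using W(2) KY by auto
      obtain q where q: "q \<in> H" "adj q y" using Yg_hub yK(1) K(1) by blast
      have qX: "q \<in> X" using q(1) H_X by blast
      have "y \<noteq> x" "y \<noteq> z" "y \<noteq> c'" "y \<noteq> p" "y \<noteq> p'"
        using yK xzK y uc(4) H_Y p(1,2) by blast+
      then show "y \<in> N2 X x \<union> N2 X z \<union> N2 X c' \<union> N2 X p \<union> N2 X p'"
        using hit[OF q(1) y q(2)] in_N2[OF yK(2) _ qX _ q(2)] by (auto simp: adj_commute)
    qed
    moreover have "col (N2 X x \<union> N2 X z \<union> N2 X c' \<union> N2 X p \<union> N2 X p') (k + k + k + k + k)"
      using xzY uc(3) KY p(1,2) H_X by (intro col_Un N2_col) auto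
    ultimately have "col W (k + k + k + k + k)" using col_mono by blast
    then show "col (comp (K - N) y0) (5 * k)" unfolding W_def by (rule col_mono) auto
  qed
  ultimately show ?thesis by (rule col_Un_le) auto
qed

text \<open>An earlier hub is encoded as one with no neighbour left in \<open>K\<close>, so the
  recursion carries no record of the order of deletion.\<close>

definition Old :: "bool \<Rightarrow> 'a set \<Rightarrow> 'a set" where
  "Old b K = {x \<in> Yg. \<exists>p\<in>H. rho p = b \<and> adj p x \<and> (\<forall>y\<in>K. \<not> adj p y)}"

lemma Old_mono: "K' \<subseteq> K \<Longrightarrow> Old b K \<subseteq> Old b K'"
  by (auto simp: Old_def)

text \<open>Delete the neighbours of a hub \<open>p\<close>, recurse into the components of large chromatic number that
  remain, and put into \<open>Z\<close> the neighbours of \<open>p\<close> that are attached to those components. By the shield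
  argument, these have no neighbours among the vertices seen by an earlier hub of the same parity.\<close>

lemma separation:
  assumes "K \<subseteq> Yg"
  shows "\<exists>Z. (\<forall>b. Z b \<subseteq> K \<and> col (Z b) 1 \<and> (\<forall>z\<in>Z b. \<forall>x\<in>Old b K. \<not> adj x z)) \<and>
    col (K - (Z True \<union> Z False)) (5 * k + 3)"
proof -
  have "finite K" using finite_subset[OF _ finite_X] assms Yg_X by blast
  then show ?thesis using assms
  proof (induction K rule: finite_psubset_induct)
    case (psubset K)
    show ?case
    proof (cases "K = {}")
      case True
      then show ?thesis by (intro exI[of _ "\<lambda>_. {}"]) simp
    next
      case False
      then obtain y p where yp: "y \<in> K" "p \<in> H" "adj p y" using Yg_hub psubset.prems by blast
      define T where "T = {y \<in> K. adj p y}"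
      define K1 where "K1 = {y \<in> K - T. \<not> col (comp (K - T) y) (5 * k + 2)}"
      have K1K: "K1 \<subseteq> K - T" "K1 \<subset> K" using yp by (auto simp: K1_def T_def)
      have K1_closed: "v \<in> K1" if "u \<in> K1" "v \<in> K - T" "adj u v" for u v
      proof -
        have "v \<in> comp (K - T) u" using comp_closed[of u "K - T" u v] that K1K by auto
        then show ?thesis using comp_eq[of v "K - T" u] that by (auto simp: K1_def)
      qed
      have light: "col (K - T - K1) (5 * k + 2)"
      proof (rule col_comps)
        fix u assume u: "u \<in> K - T - K1"
        then have "col (comp (K - T) u) (5 * k + 2)" by (auto simp: K1_def)
        moreover have "comp (K - T - K1) u \<subseteq> comp (K - T) u"
          using reach_mono[of "K - T - K1" u _ "K - T"] by (auto simp: comp_def)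
        ultimately show "col (comp (K - T - K1) u) (5 * k + 2)" using col_mono by blast
      qed
      have "K1 \<subseteq> Yg" using psubset.prems K1K(1) by blast
      from psubset.IH[OF K1K(2) this] obtain Z where
        IH: "\<forall>b. Z b \<subseteq> K1 \<and> col (Z b) 1 \<and> (\<forall>z\<in>Z b. \<forall>x\<in>Old b K1. \<not> adj x z)"
          "col (K1 - (Z True \<union> Z False)) (5 * k + 3)"
        by (elim exE conjE)
      have Z: "Z b \<subseteq> K1" "col (Z b) 1" "z \<in> Z b \<Longrightarrow> x \<in> Old b K1 \<Longrightarrow> \<not> adj x z" for b z x
        using IH(1) by blast+
      define A where "A = {z \<in> T. \<exists>w\<in>K1. adj w z}"
      define Z' where "Z' b = (if b = rho p then Z b \<union> A else Z b)" for b
      \<comment> \<open>Having lost its neighbours, \<open>p\<close> counts as earlier for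
        \<open>K1\<close>. The induction hypothesis therefore separates \<open>A\<close> from
        \<open>Z (rho p)\<close>, and both fit into one stable set.\<close>
      have T_old: "T \<subseteq> Old (rho p) K1"
        using yp(2) psubset.prems K1K(1) by (auto simp: T_def Old_def)
      have T_stable: "col T 1" unfolding T_def by (rule neighbours_stable)
      have "col (Z (rho p) \<union> A) 1"
      proof (rule col_Un_anticomplete)
        show "col A 1" using T_stable by (rule col_mono) (auto simp: A_def)
        show "\<not> adj u v" if "u \<in> Z (rho p)" "v \<in> A" for u v
          using Z(3)[of u "rho p" v] that T_old by (auto simp: A_def adj_commute)
      qed (rule Z(2))
      then have stable: "col (Z' b) 1" for b using Z(2) by (simp add: Z'_def)
      have old: "\<not> adj x z" if z: "z \<in> Z' b" and x: "x \<in> Old b K" for b x z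
      proof (cases "z \<in> Z b")
        case True
        then show ?thesis using Z(3) x Old_mono[of K1 K b] K1K(2) by blast
      next
        case False
        then have zA: "z \<in> A" "b = rho p" using z by (auto simp: Z'_def split: if_splits)
        then obtain w where w: "w \<in> K1" "adj w z" "z \<in> T" by (auto simp: A_def)
        obtain p' where p': "p' \<in> H" "rho p' = rho p" "adj p' x" "\<forall>y\<in>K. \<not> adj p' y"
          using x zA(2) by (auto simp: Old_def)
        show ?thesis
        proof
          assume "adj x z"
          have wKT: "w \<in> K - T" using w(1) K1K(1) by blast
          have sub: "comp (K - T) w \<subseteq> K - T" using comp_subset[OF wKT] .
          \<comment> \<open>This component needs more colours, as \<open>w\<close> lies in
            \<open>K1\<close>, and neither \<open>p'\<close> nor \<open>p\<close> sees it. An edge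
            between \<open>x\<close> and \<open>z\<close> would shield it.\<close>
          have "col (comp (K - T) w) (5 * k + 2)"
          proof (rule shield[of x z p' p _ w])
            show "x \<in> Yg" using x by (simp add: Old_def)
            show "z \<in> Yg" "adj p z" using w(3) psubset.prems by (auto simp: T_def)
            show "comp (K - T) w \<subseteq> Yg" using sub psubset.prems by blast
            show "\<not> adj p' y \<and> \<not> adj p y" if "y \<in> comp (K - T) w" for y
              using sub that p'(4) by (auto simp: T_def)
          qed (use \<open>adj x z\<close> p' yp(2) w(2) conn_comp in auto)
          then show False using w(1) by (simp add: K1_def)
        qed
      qed
      \<comment> \<open>\<open>T - A\<close> and the light components see nothing in
        \<open>K1\<close>. Their 1 + (5k + 2) colours can be those used in the recursion, so the
        bound does not grow with its depth.\<close>
      have "col ((K1 - (Z True \<union> Z False)) \<union> ((T - A) \<union> (K - T - K1))) (5 * k + 3)"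
      proof (rule col_Un_anticomplete)
        have "col (T - A) 1" using T_stable by (rule col_mono) auto
        then show "col ((T - A) \<union> (K - T - K1)) (5 * k + 3)" using light by (rule col_Un_le) auto
        show "\<not> adj u v" if "u \<in> K1 - (Z True \<union> Z False)" "v \<in> (T - A) \<union> (K - T - K1)" for u v
          using that K1_closed[of u v] by (auto simp: A_def)
      qed (rule IH(2))
      moreover have "K - (Z' True \<union> Z' False) \<subseteq> (K1 - (Z True \<union> Z False)) \<union> ((T - A) \<union> (K - T - K1))"
        using Z(1) by (cases "rho p") (auto simp: Z'_def)
      ultimately have "col (K - (Z' True \<union> Z' False)) (5 * k + 3)" using col_mono by blast
      moreover have "Z' b \<subseteq> K" for b
        using Z(1)[of b] K1K(2) by (auto simp: Z'_def A_def T_def)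
      ultimately show ?thesis using stable old by (intro exI[of _ Z'] conjI allI ballI)
    qed
  qed
qed

lemma col_Yg: "col Yg (5 * k + 5)"
proof -
  obtain Z where Z: "\<forall>b. Z b \<subseteq> Yg \<and> col (Z b) 1 \<and> (\<forall>z\<in>Z b. \<forall>x\<in>Old b Yg. \<not> adj x z)"
    "col (Yg - (Z True \<union> Z False)) (5 * k + 3)"
    using separation[OF order_refl] by (elim exE conjE)
  then have "col (Z True \<union> Z False) (1 + 1)" by (intro col_Un) simp_all
  then show ?thesis using Z(2) by (rule col_Un_le) auto
qed

lemma col_Y: "col Y (9 * k + 5)"
proof -
  have "Y \<subseteq> Yg \<union> (N2 X t \<union> N2 X c \<union> N2 X q0 \<union> N2 X r0)"
  proof
    fix y assume y: "y \<in> Y"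
    have yC: "y \<in> C" "y \<in> X" using y Y_C sub_X by auto
    show "y \<in> Yg \<union> (N2 X t \<union> N2 X c \<union> N2 X q0 \<union> N2 X r0)"
    proof (cases "y \<in> Yg")
      case True
      then show ?thesis by blast
    next
      case False
      then obtain q where q: "q \<in> Q" "adj q y" "q \<notin> H" using y by (auto simp: Yg_def)
      have qX: "q \<in> X" using q(1) sub_X by blast
      have "y \<noteq> t" "y \<noteq> c" using y q0_Y t(2) t_Y c(2) by blast+
      moreover have "y \<noteq> q0" "y \<noteq> r0" using yC(1) q0 r0(1) disj by blast+
      moreover have "adj q t \<or> adj q c \<or> adj q q0 \<or> adj q r0" using q y by (auto simp: H_def)
      ultimately show ?thesis
        using in_N2[OF yC(2) _ qX _ q(2)] False by (auto simp: adj_commute)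
    qed
  qed
  moreover have "col (N2 X t \<union> N2 X c \<union> N2 X q0 \<union> N2 X r0) (k + k + k + k)"
    using sub_X t(1) c(1) q0 r0(1) by (intro col_Un N2_col) auto
  ultimately show ?thesis using col_Un_le[OF col_Yg] by simp
qed

end

context pentagonal_graph
begin

text \<open>The neighbours of \<open>q\<close> take one colour, and since \<open>D\<close> is
  connected each component of the rest hangs on one of them. Two applications produce the chain
  \<open>q0\<close>, \<open>t\<close>, \<open>c\<close> that leads into \<open>Y\<close>.\<close>

lemma col_attached:
  assumes "conn D" "x \<in> D" "adj q x"
    and "\<And>Y t. t \<in> D \<Longrightarrow> adj q t \<Longrightarrow> conn Y \<Longrightarrow> Y \<subseteq> D \<Longrightarrow> \<exists>y\<in>Y. adj t y \<Longrightarrow>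
      \<forall>y\<in>Y. \<not> adj q y \<Longrightarrow> col Y m"
  shows "col D (m + 1)"
proof -
  define N where "N = {y \<in> D. adj q y}"
  have "col (D - N) m"
  proof (rule col_comps)
    fix y assume y: "y \<in> D - N"
    let ?Y = "comp (D - N) y"
    have sub: "?Y \<subseteq> D - N" by (rule comp_subset[OF y])
    then have "x \<notin> ?Y" using assms(3) by (auto simp: N_def)
    then obtain u t where ut: "u \<in> D" "u \<in> ?Y" "t \<in> D" "t \<notin> ?Y" "adj u t"
      using conn_crossing[OF assms(1), of y ?Y x] y assms(2) by auto
    then have "t \<in> N" using comp_closed[of u "D - N" y t] y by blast
    show "col ?Y m"
    proof (rule assms(4))
      show "t \<in> D" "adj q t" using \<open>t \<in> N\<close> by (auto simp: N_def)
      show "conn ?Y" by (rule conn_comp)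
      show "?Y \<subseteq> D" using sub by blast
      show "\<exists>y\<in>?Y. adj t y" using ut(2) adj_sym[OF ut(5)] by blast
      show "\<forall>y\<in>?Y. \<not> adj q y" using sub by (auto simp: N_def)
    qed
  qed
  moreover have "col N 1" unfolding N_def by (rule neighbours_stable)
  ultimately show ?thesis by (rule col_Un_le) auto
qed

end

context levels
begin

lemma col_C: "col C (9 * k + 7)"
proof (rule col_comps)
  fix x assume x: "x \<in> C"
  obtain q0 where q0: "q0 \<in> Q" "adj q0 x" using C_Q[OF x] by blast
  obtain r0 where r0: "r0 \<in> R" "adj q0 r0" using Q_R[OF q0(1)] by blast
  have sub: "comp C x \<subseteq> C" by (rule comp_subset[OF x])
  have "col (comp C x) (9 * k + 5 + 1 + 1)"
  proof (rule col_attached[OF conn_comp self_in_comp q0(2)])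
    fix K t
    assume t: "t \<in> comp C x" "adj q0 t" and K: "conn K" "K \<subseteq> comp C x" "\<exists>y\<in>K. adj t y"
      "\<forall>y\<in>K. \<not> adj q0 y"
    obtain y where y: "y \<in> K" "adj t y" using K(3) by blast
    show "col K (9 * k + 5 + 1)"
    proof (rule col_attached[OF K(1) y])
      fix Y c
      assume c: "c \<in> K" "adj t c" and Y: "conn Y" "Y \<subseteq> K" "\<exists>y\<in>Y. adj c y" "\<forall>y\<in>Y. \<not> adj t y"
      obtain w where w: "w \<in> Y" "adj c w" using Y(3) by blast
      interpret rooted_levels adj X U R Q C k Y q0 r0 t c
      proof
        show "t \<in> C" "c \<in> C" "Y \<subseteq> C" using t(1) c(1) Y(2) K(2) sub by auto
        show "conn (insert c Y)" using Y(1) w by (rule conn_insert)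
        show "\<not> adj q0 y" if "y \<in> Y" for y using K(4) Y(2) that by blast
      qed (use q0 r0 t c Y(4) in auto)
      show "col Y (9 * k + 5)" by (rule col_Y)
    qed
  qed
  then show "col (comp C x) (9 * k + 7)" by (rule col_mono) auto
qed

end

section \<open>Breadth-first levels\<close>

context sgraph
begin

primrec ball :: "'a set \<Rightarrow> 'a \<Rightarrow> nat \<Rightarrow> 'a set" where
  "ball X z 0 = {z}"
| "ball X z (Suc n) = ball X z n \<union> {y \<in> X. \<exists>w\<in>ball X z n. adj w y}"

definition level :: "'a set \<Rightarrow> 'a \<Rightarrow> nat \<Rightarrow> 'a set" where
  "level X z n = (case n of 0 \<Rightarrow> {z} | Suc m \<Rightarrow> ball X z (Suc m) - ball X z m)"

lemma ball_mono: "m \<le> n \<Longrightarrow> ball X z m \<subseteq> ball X z n"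
  by (rule lift_Suc_mono_le) auto

lemma ball_subset: "z \<in> X \<Longrightarrow> ball X z n \<subseteq> X"
  by (induction n) auto

lemma level_ball: "level X z n \<subseteq> ball X z n"
  by (auto simp: level_def split: nat.split)

lemma level_not_ball: "y \<in> level X z n \<Longrightarrow> m < n \<Longrightarrow> y \<notin> ball X z m"
  using ball_mono[of m "n - 1" X z] by (auto simp: level_def split: nat.splits)

lemma ball_level_no_edge:
  assumes "z \<in> X" "u \<in> ball X z m" "y \<in> level X z n" "Suc m < n"
  shows "\<not> adj u y"
proof
  assume "adj u y"
  then have "y \<in> ball X z (Suc m)" using assms(1-3) level_ball ball_subset by fastforce
  then show False using level_not_ball[OF assms(3,4)] by blast
qed

lemma level_parent:
  assumes "z \<in> X" "y \<in> level X z (Suc n)"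
  shows "\<exists>w\<in>level X z n. adj w y"
proof -
  obtain w where w: "w \<in> ball X z n" "adj w y" using assms(2) by (auto simp: level_def)
  have "w \<in> level X z n"
  proof (cases n)
    case 0
    then show ?thesis using w(1) by (simp add: level_def)
  next
    case (Suc m)
    then have "w \<notin> ball X z m" using ball_level_no_edge[OF assms(1) _ assms(2), of w m] w(2) by auto
    then show ?thesis using w(1) Suc by (simp add: level_def)
  qed
  then show ?thesis using w(2) by blast
qed

lemma conn_ball: "conn (ball X z n)"
proof -
  have "reach (ball X z n) z y" if "y \<in> ball X z n" for y
    using that
  proof (induction n arbitrary: y)
    case (Suc n)
    have up: "reach (ball X z (Suc n)) z w" if "w \<in> ball X z n" for w
      using reach_mono[OF Suc.IH[OF that]] by auto
    show ?case
    proof (cases "y \<in> ball X z n")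
      case True
      then show ?thesis by (rule up)
    next
      case False
      then obtain w where w: "w \<in> ball X z n" "adj w y" using Suc.prems by auto
      then have "reach (ball X z (Suc n)) w y" using Suc.prems by (intro reach_step) auto
      then show ?thesis using up[OF w(1)] reach_trans by blast
    qed
  qed simp
  then show ?thesis unfolding conn_def using reach_sym reach_trans by blast
qed

lemma levels_cover:
  assumes "conn X" "z \<in> X" "y \<in> X"
  shows "\<exists>n. y \<in> level X z n"
proof -
  have "reach X z y" using assms by (simp add: conn_def)
  then have "\<exists>n. y \<in> ball X z n"
    unfolding reach_def
  proof (induction rule: rtranclp_induct)
    case base
    show ?case by (intro exI[of _ 0]) simp
  next
    case (step u w)
    then obtain n where "u \<in> ball X z n" by blast
    then have "w \<in> ball X z (Suc n)" using step(2) by auto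
    then show ?case by blast
  qed
  then obtain n where n: "y \<in> ball X z n" "\<forall>m<n. y \<notin> ball X z m"
    using exists_least_iff[of "\<lambda>n. y \<in> ball X z n"] by blast
  then have "y \<in> level X z n" by (cases n) (auto simp: level_def)
  then show ?thesis by blast
qed

lemma col_UN_anticomplete:
  assumes "\<And>i::nat. i \<in> I \<Longrightarrow> col (F i) m"
    and "\<And>i j u v. i \<in> I \<Longrightarrow> j \<in> I \<Longrightarrow> i < j \<Longrightarrow> u \<in> F i \<Longrightarrow> v \<in> F j \<Longrightarrow> \<not> adj u v"
  shows "col (\<Union>i\<in>I. F i) m"
proof -
  have "\<forall>i\<in>I. \<exists>g. (\<forall>x\<in>F i. g x < m) \<and> (\<forall>x\<in>F i. \<forall>y\<in>F i. adj x y \<longrightarrow> g x \<noteq> g y)"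
    using assms(1) by (simp add: col_def)
  then obtain g where g: "\<forall>i\<in>I. (\<forall>x\<in>F i. g i x < m) \<and> (\<forall>x\<in>F i. \<forall>y\<in>F i. adj x y \<longrightarrow> g i x \<noteq> g i y)"
    by metis
  have "\<forall>x\<in>\<Union>i\<in>I. F i. \<exists>i. i \<in> I \<and> x \<in> F i" by blast
  then obtain d where d: "\<forall>x\<in>\<Union>i\<in>I. F i. d x \<in> I \<and> x \<in> F (d x)" by metis
  have same: "d x = d y" if "x \<in> (\<Union>i\<in>I. F i)" "y \<in> (\<Union>i\<in>I. F i)" "adj x y" for x y
  proof (rule ccontr)
    assume "d x \<noteq> d y"
    then consider "d x < d y" | "d y < d x" by linarith
    then show False
      by cases (use assms(2)[of "d x" "d y" x y] assms(2)[of "d y" "d x" y x] d that adj_sym in blast)+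
  qed
  show ?thesis
    unfolding col_def
  proof (intro exI[of _ "\<lambda>x. g (d x) x"] conjI ballI impI)
    show "g (d x) x < m" if "x \<in> (\<Union>i\<in>I. F i)" for x using g d that by blast
    show "g (d x) x \<noteq> g (d y) y" if xy: "x \<in> (\<Union>i\<in>I. F i)" "y \<in> (\<Union>i\<in>I. F i)" "adj x y" for x y
      using g d xy same[OF xy] by metis
  qed
qed

end

section \<open>From single levels to the whole graph\<close>

context pentagonal_graph
begin

text \<open>The parity argument needs \<open>R\<close>, \<open>Q\<close> and a non-empty
  \<open>U\<close> above the level, so it starts at level three. The levels 0 and 1 are stable, and
  level 2 lies in \<open>N2 X z\<close>.\<close>

lemma col_level:
  assumes "finite X" "\<And>x. x \<in> X \<Longrightarrow> col (N2 X x) k" "z \<in> X"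
  shows "col (level X z n) (9 * k + 7)"
proof -
  consider "n = 0" | "n = 1" | "n = 2" | i where "n = Suc (Suc (Suc i))"
    by (metis One_nat_def Suc_1 not0_implies_Suc)
  then show ?thesis
  proof cases
    case 1
    have "col (level X z n) 1" by (rule col_stable) (auto simp: 1 level_def adj_irrefl)
    then show ?thesis by (rule col_mono) auto
  next
    case 2
    have "level X z n \<subseteq> {y \<in> X. adj z y}" by (auto simp: 2 level_def)
    then show ?thesis using col_mono[OF neighbours_stable[of X z]] by simp
  next
    case 3
    have "level X z n \<subseteq> N2 X z"
    proof
      fix y assume y: "y \<in> level X z n"
      then have y2: "y \<in> level X z (Suc 1)" using 3 by (simp add: numeral_2_eq_2)
      obtain w where w: "w \<in> level X z (Suc 0)" "adj w y" using level_parent[OF assms(3) y2] by auto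
      obtain u where "u \<in> level X z 0" "adj u w" using level_parent[OF assms(3) w(1)] by blast
      then have "adj z w" by (simp add: level_def)
      moreover have "y \<in> X" "w \<in> X" using y w(1) level_ball ball_subset[OF assms(3)] by blast+
      moreover have "y \<noteq> z" using level_not_ball[OF y, of 0] 3 by auto
      ultimately show "y \<in> N2 X z" using w(2) by (intro in_N2)
    qed
    then show ?thesis using col_mono[OF assms(2)[OF assms(3)]] by simp
  next
    case 4
    interpret levels adj X "ball X z i" "level X z (Suc i)" "level X z (Suc (Suc i))" "level X z n" k
    proof
      show "ball X z i \<union> level X z (Suc i) \<union> level X z (Suc (Suc i)) \<union> level X z n \<subseteq> X"
        using level_ball ball_subset[OF assms(3)] by (meson Un_least subset_trans)
      show "ball X z i \<inter> level X z (Suc (Suc i)) = {}" "ball X z i \<inter> level X z n = {}"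
        using level_not_ball 4 by fastforce+
      show "level X z (Suc i) \<inter> level X z (Suc (Suc i)) = {}" "level X z (Suc i) \<inter> level X z n = {}"
        using level_not_ball[of _ X z _ "Suc i"] level_ball[of X z "Suc i"] 4 by fastforce+
      show "level X z (Suc (Suc i)) \<inter> level X z n = {}"
        using level_not_ball[of _ X z n "Suc (Suc i)"] level_ball[of X z "Suc (Suc i)"] 4 by fastforce
      show "conn (ball X z i)" by (rule conn_ball)
      show "\<exists>u\<in>ball X z i. adj r u" if "r \<in> level X z (Suc i)" for r
        using level_parent[OF assms(3) that] level_ball adj_sym by blast
      show "\<exists>r\<in>level X z (Suc i). adj q r" if "q \<in> level X z (Suc (Suc i))" for q
        using level_parent[OF assms(3) that] adj_sym by blast
      show "\<exists>q\<in>level X z (Suc (Suc i)). adj q y" if "y \<in> level X z n" for y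
        using level_parent[OF assms(3)] that 4 by blast
      show "\<not> adj u y" if "u \<in> ball X z i \<union> level X z (Suc i)" "y \<in> level X z n" for u y
      proof -
        have "u \<in> ball X z (Suc i)" using that(1) level_ball[of X z "Suc i"] by auto
        then show ?thesis using ball_level_no_edge[OF assms(3) _ that(2), of u "Suc i"] 4 by simp
      qed
      show "\<not> adj u q" if "u \<in> ball X z i" "q \<in> level X z (Suc (Suc i))" for u q
        using ball_level_no_edge[OF assms(3) that] by simp
    qed (use assms in auto)
    show ?thesis by (rule col_C)
  qed
qed

lemma col_of_N2:
  assumes "finite X" "\<And>x. x \<in> X \<Longrightarrow> col (N2 X x) k"
  shows "col X (18 * k + 14)"
proof (rule col_comps)
  fix z assume z: "z \<in> X"
  define D where "D = comp X z"
  have D: "conn D" "D \<subseteq> X" "z \<in> D" using conn_comp comp_subset[OF z] by (simp_all add: D_def)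
  have fin: "finite D" using finite_subset[OF D(2) assms(1)] .
  have N2D: "col (N2 D x) k" if "x \<in> D" for x
  proof (rule col_mono[OF assms(2)])
    show "N2 D x \<subseteq> N2 X x" using D(2) by (auto simp: N2_def)
  qed (use that D(2) in auto)
  \<comment> \<open>Two levels of equal parity are never consecutive, hence have no edges between
    them and can share colours.\<close>
  have half: "col (\<Union>n\<in>I. level D z n) (9 * k + 7)" if "I = Collect even \<or> I = Collect odd" for I
  proof (rule col_UN_anticomplete)
    show "col (level D z i) (9 * k + 7)" for i by (rule col_level[OF fin N2D D(3)])
    fix i j u v assume ij: "i \<in> I" "j \<in> I" "i < j" and uv: "u \<in> level D z i" "v \<in> level D z j"
    have "Suc i \<noteq> j" using ij(1,2) that by auto
    then show "\<not> adj u v" using ball_level_no_edge[OF D(3) _ uv(2), of u i] uv(1) level_ball ij(3) by auto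
  qed
  have "D \<subseteq> (\<Union>n\<in>Collect even. level D z n) \<union> (\<Union>n\<in>Collect odd. level D z n)"
  proof
    fix y assume "y \<in> D"
    then obtain n where "y \<in> level D z n" using levels_cover[OF D(1,3)] by blast
    then show "y \<in> (\<Union>n\<in>Collect even. level D z n) \<union> (\<Union>n\<in>Collect odd. level D z n)"
      by (cases "even n") auto
  qed
  then show "col (comp X z) (18 * k + 14)"
    unfolding D_def[symmetric] using col_Un_le[OF half[OF disjI1] half[OF disjI2]] by simp
qed

theorem col_pentagonal:
  assumes "finite V"
  shows "col V 52430"
proof -
  have "col (N2 V v) 2912" for v
  proof -
    define C where "C = N2 V v"
    define Q where "Q = {s \<in> V. adj v s}"
    have finC: "finite C" using assms finite_subset[OF N2_subset] by (auto simp: C_def)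
    have Q: "adj v s" if "s \<in> Q" for s using that by (simp add: Q_def)
    have C: "\<not> adj v y" "\<exists>s\<in>Q. adj s y" if "y \<in> C" for y using that by (auto simp: C_def Q_def N2_def)
    have "col (N2 C a) 161" if a: "a \<in> C" for a
    proof -
      define A where "A = {y \<in> C. adj a y}"
      have A: "adj a r" "\<not> adj v r" "\<exists>p\<in>Q. adj p r" if "r \<in> A" for r using that C by (auto simp: A_def)
      have N: "y \<in> C" "\<not> adj a y" "\<exists>r\<in>A. adj r y" if "y \<in> N2 C a" for y
        using that by (auto simp: N2_def A_def)
      have fin: "finite S" if "S \<subseteq> N2 C a" for S
        using finC N2_subset finite_subset that by metis
      obtain z where z: "z \<in> Q" "adj a z" using C(2)[OF a] adj_sym by blast
      define D where "D = {y \<in> N2 C a. \<not> adj z y \<and> (\<exists>s\<in>Q. adj s y \<and> \<not> adj s a)}"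
      \<comment> \<open>Three colours deal with the vertices that \<open>triple_cover\<close> does
        not admit: two for those whose neighbours in \<open>Q\<close> all see \<open>a\<close>, one
        for the neighbours of \<open>z\<close>.\<close>
      have "col {y \<in> N2 C a. \<forall>s\<in>Q. adj s y \<longrightarrow> adj s a} 2"
        by (rule cap_bipartite[of _ Q v A a]) (use fin Q A N C adj_sym in auto)
      moreover have "col {y \<in> N2 C a. adj z y} 1" by (rule neighbours_stable)
      moreover have "col D (18 * 8 + 14)"
      proof (rule col_of_N2)
        show "finite D" by (rule fin) (auto simp: D_def)
        fix b assume b: "b \<in> D"
        show "col (N2 D b) 8"
          by (rule triple_cover[OF \<open>finite D\<close> Q A z C(1)[OF a] _ _ _ _ _ b]) (use N C in \<open>auto simp: D_def\<close>)
      qed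
      ultimately have "col ({y \<in> N2 C a. \<forall>s\<in>Q. adj s y \<longrightarrow> adj s a} \<union> {y \<in> N2 C a. adj z y} \<union> D)
          (2 + 1 + (18 * 8 + 14))"
        by (intro col_Un)
      then show ?thesis by (rule col_mono) (auto simp: D_def)
    qed
    then have "col C (18 * 161 + 14)" by (rule col_of_N2[OF finC])
    then show ?thesis by (simp add: C_def)
  qed
  then have "col V (18 * 2912 + 14)" by (rule col_of_N2[OF assms])
  then show ?thesis by simp
qed

end

section \<open>Induced cycles as lists of vertices\<close>

lemma pcas_closed: "pcas u (zip (u # vs) (vs @ [w])) w"
  by (induction vs arbitrary: u) auto

lemma pawalk_verts_closed: "pawalk_verts u (zip (u # vs) (vs @ [w])) = u # vs @ [w]"
  by (induction vs arbitrary: u) auto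

text \<open>Makes the number of edges equal to the number of arcs of the closed walk. With only two
  vertices, both arcs would give the same edge.\<close>

lemma inj_on_cycle_edges:
  assumes "distinct c" "length c \<ge> 3"
  shows "inj_on (\<lambda>(u, v). {u, v}) (set (zip c (rotate1 c)))"
proof (rule inj_onI)
  fix a b
  assume a: "a \<in> set (zip c (rotate1 c))" and b: "b \<in> set (zip c (rotate1 c))"
    and eq: "(\<lambda>(u, v). {u, v}) a = (\<lambda>(u, v). {u, v}) b"
  obtain i where i: "i < length c" "a = (c ! i, c ! (Suc i mod length c))"
    using a by (auto simp: set_zip nth_rotate1)
  obtain j where j: "j < length c" "b = (c ! j, c ! (Suc j mod length c))"
    using b by (auto simp: set_zip nth_rotate1)
  have lt: "Suc m mod length c < length c" for m using i(1) by (intro mod_less_divisor) (cases c; simp)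
  have "i = j \<or> (i = Suc j mod length c \<and> j = Suc i mod length c)"
    using eq i j lt nth_eq_iff_index_eq[OF assms(1)] by (auto simp: doubleton_eq_iff)
  moreover have "\<not> (i = Suc j mod length c \<and> j = Suc i mod length c)"
    using i(1) j(1) assms(2) by (auto simp: mod_Suc split: if_splits)
  ultimately show "a = b" using i(2) j(2) by blast
qed

text \<open>Pairing \<open>c\<close> with its rotation lists the arcs of the closed walk, including
  the one from the last vertex back to the first; \<open>arcs\<close> is what makes the resulting
  cycle an induced subgraph.\<close>

lemma pentagonal_cycle_list:
  fixes G :: "'a pair_pre_digraph"
  assumes "pair_graph G" "pentagonal G"
    and c: "distinct c" "length c \<ge> 3" "odd (length c)" "set c \<subseteq> pverts G"
    and arcs: "\<And>u v. u \<in> set c \<Longrightarrow> v \<in> set c \<Longrightarrow> (u, v) \<in> parcs G \<longleftrightarrow>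
      (u, v) \<in> set (zip c (rotate1 c)) \<or> (v, u) \<in> set (zip c (rotate1 c))"
  shows "length c = 5"
proof -
  interpret G: pair_graph G by fact
  define p where "p = zip c (rotate1 c)"
  define C where "C = \<lparr>pverts = set c, parcs = set p \<union> (set p)\<inverse>\<rparr>"
  have pc: "u \<in> set c" "v \<in> set c" if "(u, v) \<in> set p" for u v
    using set_zip_leftD[of u v c "rotate1 c"] set_zip_rightD[of u v c "rotate1 c"] that by (auto simp: p_def)
  have parcs_C: "parcs C = {e \<in> parcs G. fst e \<in> set c \<and> snd e \<in> set c}"
    using pc arcs by (fastforce simp: C_def p_def)
  have sym: "symmetric (with_proj C)" by (auto simp: symmetric_def C_def sym_def)
  have C: "pair_graph C"
    by unfold_locales (use parcs_C sym G.pair_no_loops in \<open>auto simp: C_def\<close>)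
  obtain x vs where x: "c = x # vs" using c(2) by (cases c) auto
  have "pre_digraph.cycle (with_proj C) p"
  proof -
    have "pcas x p x" "pawalk_verts x p = c @ [x]"
      using pcas_closed[of x vs x] pawalk_verts_closed[of x vs x] by (simp_all add: p_def x)
    moreover have "x \<in> pverts C" "set p \<subseteq> parcs C" by (auto simp: C_def x)
    moreover have "p \<noteq> []" by (simp add: p_def x)
    ultimately show ?thesis
      using c(1) unfolding pre_digraph.cycle_def pre_digraph.awalk_def
      by (auto simp: cas_with_proj_eq awalk_verts_with_proj_eq x)
  qed
  moreover have "length p = length c" "fst ` set p = set c"
    by (simp_all add: p_def flip: list.set_map)
  ultimately have "is_cycle_graph C"
    using C c(2) unfolding is_cycle_graph_def by (intro conjI exI[of _ p]) (simp_all add: C_def)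
  moreover have "induced_subgraph (with_proj C) (with_proj G)"
  proof -
    have "wf_digraph (with_proj C)" "wf_digraph (with_proj G)"
      using C by (auto simp: wf_digraph_wp_iff pair_graph_def pair_digraph_def pair_fin_digraph_def G.pair_wf_digraph)
    then show ?thesis
      unfolding induced_subgraph_def subgraph_def compatible_def
      using parcs_C c(4) by (auto simp: C_def)
  qed
  moreover have "cycle_length C = length c"
  proof -
    have "edges C = (\<lambda>(u, v). {u, v}) ` set p" by (force simp: edges_def C_def)
    moreover have "card (set p) = length c"
      using c(1) by (simp add: p_def distinct_card distinct_zipI1)
    ultimately show ?thesis
      using card_image[OF inj_on_cycle_edges[OF c(1,2)]] by (simp add: cycle_length_def p_def)
  qed
  ultimately show ?thesis using assms(2) c(3) unfolding pentagonal_def induced_cycle_def by metis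
qed

lemma set_zip_tl_snoc:
  "ys \<noteq> [] \<Longrightarrow> set (zip ys (tl ys @ [x])) = insert (last ys, x) (set (zip ys (tl ys)))"
proof (induction ys rule: list_nonempty_induct)
  case (cons y ys)
  then show ?case by (cases ys) auto
qed simp

lemma pentagonal_graph_parcs:
  fixes G :: "'a pair_pre_digraph"
  assumes "pair_graph G" "pentagonal G"
  shows "pentagonal_graph (\<lambda>u v. (u, v) \<in> parcs G)"
proof -
  interpret G: pair_graph G by fact
  have sym: "(v, u) \<in> parcs G" if "(u, v) \<in> parcs G" for u v
    using G.sym_arcs that by (auto simp: symmetric_def sym_def)
  interpret sgraph "\<lambda>u v. (u, v) \<in> parcs G"
  proof
    show "(u, u) \<notin> parcs G" for u using G.pair_no_loops[of "(u, u)"] by auto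
  qed (rule sym)
  show ?thesis
  proof
    fix ys x
    assume ys: "length ys \<ge> 2" "ipath ys" "x \<notin> set ys" "(x, hd ys) \<in> parcs G" "(x, last ys) \<in> parcs G"
      "\<forall>z\<in>set ys. (x, z) \<in> parcs G \<longrightarrow> z = hd ys \<or> z = last ys" "even (length ys)"
    have ne: "ys \<noteq> []" using ys(1) by auto
    obtain y zs where yz: "ys = y # zs" using ne by (cases ys) auto
    have steps: "set (zip (x # ys) (rotate1 (x # ys))) =
        insert (x, hd ys) (insert (last ys, x) (set (zip ys (tl ys))))"
      using set_zip_tl_snoc[OF ne, of x] by (simp add: yz)
    have mem: "u \<in> set ys" "v \<in> set ys" if "(u, v) \<in> set (zip ys (tl ys))" for u v
      using set_zip_leftD[OF that] set_zip_rightD[OF that] by (auto simp: yz)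
    have ends: "hd ys \<in> set ys" "last ys \<in> set ys" using ne by auto
    have x_arc: "(x, z) \<in> parcs G \<longleftrightarrow> z = hd ys \<or> z = last ys" if "z \<in> set ys" for z
      using ys(4-6) that by blast
    have arcs: "(u, v) \<in> parcs G \<longleftrightarrow>
        (u, v) \<in> set (zip (x # ys) (rotate1 (x # ys))) \<or> (v, u) \<in> set (zip (x # ys) (rotate1 (x # ys)))"
      if uv: "u \<in> set (x # ys)" "v \<in> set (x # ys)" for u v
    proof -
      consider "u = x" "v = x" | "u = x" "v \<in> set ys" | "u \<in> set ys" "v = x" | "u \<in> set ys" "v \<in> set ys"
        using uv by auto
      then show ?thesis
      proof cases
        case 1
        then show ?thesis using mem ys(3) ends G.pair_no_loops[of "(x, x)"] unfolding steps by auto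
      next
        case 2
        then show ?thesis using mem ys(3) ends x_arc[of v] unfolding steps by auto
      next
        case 3
        then show ?thesis using mem ys(3) ends x_arc[of u] adj_commute[of u x] unfolding steps by auto
      next
        case 4
        then show ?thesis using ipath_adj_iff[OF ys(2), of u v] ys(3) unfolding steps by auto
      qed
    qed
    \<comment> \<open>\<open>ipath\<close> speaks about all elements of the type, so membership in
      the vertex set has to come from the arc of the closed walk that starts at the vertex.\<close>
    have "set (x # ys) \<subseteq> pverts G"
    proof
      fix u assume "u \<in> set (x # ys)"
      then obtain v where "(u, v) \<in> set (zip (x # ys) (rotate1 (x # ys)))"
        by (metis in_set_impl_in_set_zip1 length_rotate1)
      then have "(u, v) \<in> parcs G"
        using arcs[of u v] set_zip_leftD[of u v] set_zip_rightD[of u v] by (metis set_rotate1)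
      then show "u \<in> pverts G" by (rule G.in_arcsD1)
    qed
    then have "length (x # ys) = 5"
      using pentagonal_cycle_list[OF assms, of "x # ys"] arcs ipath_distinct[OF ys(2)] ys by simp
    then show "length ys = 4" by simp
  qed
qed

theorem mainTheorem1:
  fixes G :: "'a pair_pre_digraph"
  assumes "pair_graph G"
    and "pentagonal G"
  shows "colourable G 58000 \<and> chromatic_number G \<le> 58000"
proof -
  interpret G: pair_graph G by fact
  interpret pentagonal_graph "\<lambda>u v. (u, v) \<in> parcs G" by (rule pentagonal_graph_parcs[OF assms])
  have "col (pverts G) 58000"
    using col_pentagonal[OF G.pair_finite_verts] by (rule col_mono) auto
  then obtain f :: "'a \<Rightarrow> nat" where f: "\<forall>u\<in>pverts G. f u < 58000"
    "\<forall>u\<in>pverts G. \<forall>v\<in>pverts G. (u, v) \<in> parcs G \<longrightarrow> f u \<noteq> f v"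
    unfolding col_def by blast
  have "proper_colouring G 58000 f"
    using f G.in_arcsD1 G.in_arcsD2 by (auto simp: proper_colouring_def)
  then have "colourable G 58000" by (auto simp: colourable_def)
  then show ?thesis using chromatic_number_le_iff[OF assms(1)] by simp
qed

end
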